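(* Let $m\ge1$ and $d>1$ be integers, $c_1$ a positive integer and $c_2,\dots,c_{m+1}$ non-negative integers with $c_1\ge dc_2$. Let $M=M_{c_1,\dots,c_{m+1},d}$ be the $m\times(m+d)$ integer matrix whose $j$-th column, for $j=1,\dots,d+1$, is $(c_1-(j-1)c_2,\,(j-1)c_3,\,(j-1)c_4,\dots,(j-1)c_{m+1})^T$, and whose $(d+i)$-th column, for $i=2,\dots,m$, is $c_1\mathbf e_i$ ($\mathbf e_i$ the $i$-th standard basis vector of $\mathbb Z^m$); assume every column of $M$ is nonzero. Then the toric ideal $I_M\subseteq K[x_1,\dots,x_{m+d}]$, which has height $d$, is a set-theoretic complete intersection.
   Context: $K$ is a field. For an integer matrix $M$ with columns $\mathbf a_i$ (each nonzero), the toric ideal $I_M$ is the kernel of $x_i\mapsto\mathbf t^{\mathbf a_i}\in K[t_1^{\pm1},\dots,t_m^{\pm1}]$. An ideal $I$ is a set-theoretic complete intersection if $I=\mathrm{rad}(g_1,\dots,g_h)$ for some polynomials $g_1,\dots,g_h$ with $h=\mathrm{ht}(I)$. *)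

theory Defs
  imports "HOL-Library.Poly_Mapping" "HOL-Library.Extended_Nat" "HOL-Algebra.Ideal"
begin

text \<open>Multivariate polynomials over a field: ('x \<Rightarrow>0 nat) \<Rightarrow>0 'k (monomial = exponent
  vector, polynomial = finitely supported coefficient map, product = convolution).
  Variables are x_0,...,x_(n-1) (the paper's x_1,...,x_n shifted by one).\<close>

type_synonym 'k mpoly = "(nat \<Rightarrow>\<^sub>0 nat) \<Rightarrow>\<^sub>0 'k"

type_synonym 'k lpoly = "(nat \<Rightarrow>\<^sub>0 int) \<Rightarrow>\<^sub>0 'k"

definition poly_carrier :: "nat \<Rightarrow> 'k::field mpoly set" where
  "poly_carrier n = {p. \<forall>\<alpha>\<in>Poly_Mapping.keys p. Poly_Mapping.keys \<alpha> \<subseteq> {..<n}}"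

definition polyR :: "nat \<Rightarrow> 'k::field mpoly ring" where
  "polyR n = \<lparr>carrier = poly_carrier n, monoid.mult = (*), one = 1, zero = 0, add = (+)\<rparr>"

text \<open>An integer matrix is given as a function (row, column) -> int; rows 0..<m, columns 0..<n.
  The image of x^alpha is t^(M alpha).\<close>
definition mat_exp :: "nat \<Rightarrow> (nat \<Rightarrow> nat \<Rightarrow> int) \<Rightarrow> (nat \<Rightarrow>\<^sub>0 nat) \<Rightarrow> (nat \<Rightarrow>\<^sub>0 int)" where
  "mat_exp m M \<alpha> = (\<Sum>i\<in>Poly_Mapping.keys \<alpha>. \<Sum>r<m. Poly_Mapping.single r (M r i * int (Poly_Mapping.lookup \<alpha> i)))"

definition toric_map :: "nat \<Rightarrow> (nat \<Rightarrow> nat \<Rightarrow> int) \<Rightarrow> 'k::field mpoly \<Rightarrow> 'k lpoly" where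
  "toric_map m M f = (\<Sum>\<alpha>\<in>Poly_Mapping.keys f. Poly_Mapping.single (mat_exp m M \<alpha>) (Poly_Mapping.lookup f \<alpha>))"

definition toric_ideal :: "nat \<Rightarrow> nat \<Rightarrow> (nat \<Rightarrow> nat \<Rightarrow> int) \<Rightarrow> 'k::field mpoly set" where
  "toric_ideal m n M = {f \<in> poly_carrier n. toric_map m M f = 0}"

definition radical_of :: "('a, 'b) ring_scheme \<Rightarrow> 'a set \<Rightarrow> 'a set" where
  "radical_of R I = {f \<in> carrier R. \<exists>k::nat. f [^]\<^bsub>R\<^esub> k \<in> I}"

definition prime_height :: "('a, 'b) ring_scheme \<Rightarrow> 'a set \<Rightarrow> enat" where
  "prime_height R P = (SUP l \<in> {l. \<exists>Q::nat \<Rightarrow> 'a set. (\<forall>i\<le>l. primeideal (Q i) R)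
       \<and> (\<forall>i<l. Q i \<subset> Q (Suc i)) \<and> Q l = P}. enat l)"

definition ideal_height :: "('a, 'b) ring_scheme \<Rightarrow> 'a set \<Rightarrow> enat" where
  "ideal_height R I = (INF P \<in> {P. primeideal P R \<and> I \<subseteq> P}. prime_height R P)"

definition set_theoretic_ci :: "('a, 'b) ring_scheme \<Rightarrow> 'a set \<Rightarrow> bool" where
  "set_theoretic_ci R I = (\<exists>gs. set gs \<subseteq> carrier R \<and> enat (length gs) = ideal_height R I
       \<and> I = radical_of R (genideal R (set gs)))"

text \<open>The matrix M_{c_1,...,c_(m+1),d} (0-based rows/columns; c is 1-based as in the paper):
  column j (0 \<le> j \<le> d) = (c_1 - j c_2, j c_3, ..., j c_(m+1));
  column d+k (1 \<le> k \<le> m-1) = c_1 e_k (row k, 0-based).\<close>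
definition Mcd :: "nat \<Rightarrow> nat \<Rightarrow> (nat \<Rightarrow> nat) \<Rightarrow> nat \<Rightarrow> nat \<Rightarrow> int" where
  "Mcd m d c r j =
     (if r < m \<and> j \<le> d then
        (if r = 0 then int (c 1) - int j * int (c 2) else int j * int (c (r + 2)))
      else if r < m \<and> d < j \<and> j < m + d then
        (if r = j - d then int (c 1) else 0)
      else 0)"

end

theory Submission
  imports Defs
begin

text \<open>
  Put \<open>u = x\<^sub>0\<close> and \<open>y\<^sub>k = x\<^bsub>d+k\<^esub>\<close>. The toric parametrization is \<open>x\<^sub>j = u v\<^sup>j\<close> for \<open>j \<le> d\<close>, and after
  dividing \<open>c\<^sub>1, \<dots>, c\<^bsub>m+1\<^esub>\<close> by their gcd the only relation between \<open>u\<close>, \<open>v\<close> and the \<open>y\<^sub>k\<close> is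
  \<open>u\<^sup>q v\<^sup>p = w\<close>, where \<open>p\<close>, \<open>q\<close> are the reduced \<open>c\<^sub>1\<close>, \<open>c\<^sub>2\<close> and \<open>w\<close> is a monomial in the \<open>y\<^sub>k\<close>.
  The equations are the \<open>d - 1\<close> polynomials known to cut out the rational normal curve, the \<open>i\<close>-th of
  which equals \<open>u (x\<^bsub>i+1\<^esub> - v x\<^sub>i)\<^sup>i\<close> once \<open>x\<^sub>j = u v\<^sup>j\<close> for \<open>j \<le> i\<close>, and a last one which rewrites
  \<open>u\<^bsup>p-dq\<^esup> (u\<^sup>q v\<^sup>p - w)\<^sup>d\<close> in monomials of the \<open>x\<^sub>j\<close>, with leading term \<open>x\<^sub>d\<^sup>p\<close>. A prime containing them
  contains every binomial of the toric ideal: if \<open>u\<close> is not in the prime, one solves for the \<open>x\<^sub>j\<close>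
  successively; if it is, then so are \<open>x\<^sub>1, \<dots>, x\<^bsub>d-1\<^esub>\<close>, and the last equation controls \<open>x\<^sub>d\<close>.

  For the height, a chain of \<open>l\<close> primes below a prime modulo which \<open>m\<close> variables are independent yields
  \<open>m + l\<close> algebraically independent polynomials in \<open>m + d\<close> variables, so \<open>l \<le> d\<close> by counting
  monomials; a chain of length \<open>d\<close> comes from giving \<open>x\<^sub>1, \<dots>, x\<^sub>d\<close> independent extra parameters and
  specializing them to \<open>1\<close> one at a time.
\<close>

section \<open>Primes containing the equations\<close>

text \<open>Primes are plain sets in a type-class ring, so the arithmetic needs no carrier
  conditions; \<open>retract\<close> later carries the primes of \<open>polyR n\<close> into this
  setting.\<close>

locale prime_ideal_set =
  fixes P :: "'a::comm_ring_1 set"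
  assumes zero_mem: "0 \<in> P"
    and add_mem: "a \<in> P \<Longrightarrow> b \<in> P \<Longrightarrow> a + b \<in> P"
    and mult_mem: "b \<in> P \<Longrightarrow> a * b \<in> P"
    and one_notin: "1 \<notin> P"
    and prime_mem: "a * b \<in> P \<Longrightarrow> a \<in> P \<or> b \<in> P"
begin

lemma mult_mem': "a \<in> P \<Longrightarrow> a * b \<in> P"
  using mult_mem[of a b] by (simp add: mult.commute)

lemma uminus_mem: "a \<in> P \<Longrightarrow> - a \<in> P"
  using mult_mem[of a "-1"] by simp

lemma diff_mem: "a \<in> P \<Longrightarrow> b \<in> P \<Longrightarrow> a - b \<in> P"
  using add_mem[of a "-b"] uminus_mem[of b] by simp

lemma sum_mem: "(\<And>i. i \<in> A \<Longrightarrow> f i \<in> P) \<Longrightarrow> sum f A \<in> P"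
  by (induction A rule: infinite_finite_induct) (auto simp: zero_mem add_mem)

lemma power_memD: "a ^ k \<in> P \<Longrightarrow> a \<in> P"
  by (induction k) (use one_notin prime_mem in auto)

lemma power_mem: "a \<in> P \<Longrightarrow> k > 0 \<Longrightarrow> a ^ k \<in> P"
  by (cases k) (auto simp: mult_mem')

lemma prod_mem: "finite A \<Longrightarrow> i \<in> A \<Longrightarrow> f i \<in> P \<Longrightarrow> prod f A \<in> P"
  by (simp add: prod.remove mult_mem')

text \<open>Equality in the quotient by \<open>P\<close>, without forming the quotient ring.\<close>

definition cong :: "'a \<Rightarrow> 'a \<Rightarrow> bool" (infix \<open>\<approx>\<close> 50) where
  "a \<approx> b \<longleftrightarrow> a - b \<in> P"

lemma cong_refl [simp]: "a \<approx> a"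
  by (simp add: cong_def zero_mem)

lemma cong_sym: "a \<approx> b \<Longrightarrow> b \<approx> a"
  unfolding cong_def using uminus_mem[of "a - b"] by simp

lemma cong_trans [trans]: "a \<approx> b \<Longrightarrow> b \<approx> c \<Longrightarrow> a \<approx> c"
  unfolding cong_def using add_mem[of "a - b" "b - c"] by simp

lemma cong_eq_trans [trans]: "a \<approx> b \<Longrightarrow> b = c \<Longrightarrow> a \<approx> c"
  and eq_cong_trans [trans]: "a = b \<Longrightarrow> b \<approx> c \<Longrightarrow> a \<approx> c"
  by simp_all

lemma cong_mult: "a \<approx> b \<Longrightarrow> c \<approx> d \<Longrightarrow> a * c \<approx> b * d"
  unfolding cong_def using add_mem[OF mult_mem'[of "a - b" c] mult_mem[of "c - d" b]]
  by (simp add: algebra_simps)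

lemma cong_sum: "(\<And>i. i \<in> A \<Longrightarrow> f i \<approx> g i) \<Longrightarrow> sum f A \<approx> sum g A"
  unfolding cong_def using sum_mem[of A "\<lambda>i. f i - g i"] by (simp add: sum_subtractf)

lemma cong_prod: "(\<And>i. i \<in> A \<Longrightarrow> f i \<approx> g i) \<Longrightarrow> prod f A \<approx> prod g A"
  by (induction A rule: infinite_finite_induct) (auto simp: cong_mult)

lemma cong_power: "a \<approx> b \<Longrightarrow> a ^ k \<approx> b ^ k"
  by (induction k) (auto simp: cong_mult)

lemma cong_mem: "a \<approx> b \<Longrightarrow> a \<in> P \<longleftrightarrow> b \<in> P"
  unfolding cong_def using add_mem[of "a - b" b] diff_mem[of a "a - b"] by auto

lemma cong_cancel: "u * a \<approx> u * b \<Longrightarrow> u \<notin> P \<Longrightarrow> a \<approx> b"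
  unfolding cong_def using prime_mem[of u "a - b"] by (simp add: right_diff_distrib)

lemma cong_power_cancel: "u ^ k * a \<approx> u ^ k * b \<Longrightarrow> u \<notin> P \<Longrightarrow> a \<approx> b"
  using cong_cancel power_memD by blast

end

text \<open>This is the binomial expansion of \<open>u * (x (i+1) - v * x i) ^ i\<close> with each
  \<open>u * v ^ a\<close> rewritten as \<open>x a\<close>; for \<open>i = 1\<close> it is
  \<open>x 0 * x 2 - x 1 ^ 2\<close>.\<close>

definition scroll_poly :: "(nat \<Rightarrow> 'a::comm_ring_1) \<Rightarrow> nat \<Rightarrow> 'a" where
  "scroll_poly x i = (\<Sum>a\<le>i. (-1) ^ a * of_nat (i choose a) * (x a * x i ^ a * x (Suc i) ^ (i - a)))"

text \<open>A monomial in \<open>x\<^sub>0, \<dots>, x\<^sub>d\<close> taking the value \<open>u\<^sup>a v\<^sup>b\<close> at \<open>x\<^sub>j = u v\<^sup>j\<close>; it exists iff \<open>b \<le> d * a\<close>,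
  and \<open>x\<^sub>d\<^sup>a\<close> must be used only if \<open>b = d * a\<close>.\<close>
definition uv_monomial :: "(nat \<Rightarrow> 'a::comm_ring_1) \<Rightarrow> nat \<Rightarrow> nat \<Rightarrow> nat \<Rightarrow> 'a" where
  "uv_monomial x d a b = (if b = d * a then x d ^ a
     else x d ^ (b div d) * x (b mod d) * x 0 ^ (a - b div d - 1))"

text \<open>This is the binomial expansion of
  \<open>u ^ (p - d * q) * (u ^ q * v ^ p - w) ^ d\<close> with each power product of
  \<open>u\<close> and \<open>v\<close> rewritten as a monomial in the \<open>x j\<close>.\<close>

definition last_poly :: "(nat \<Rightarrow> 'a::comm_ring_1) \<Rightarrow> 'a \<Rightarrow> nat \<Rightarrow> nat \<Rightarrow> nat \<Rightarrow> 'a" where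
  "last_poly x w d p q = (\<Sum>a\<le>d. of_nat (d choose a) * uv_monomial x d (q * a + (p - d * q)) (p * a)
      * (- w) ^ (d - a))"

text \<open>The \<open>a\<close>-th term of \<open>last_poly\<close> carries
  \<open>u ^ (q * a + (p - d * q)) * v ^ (p * a)\<close>. The second claim is the bound under which
  \<open>uv_monomial\<close> represents it; the first measures the slack, which for
  \<open>p > d * q\<close> vanishes only at \<open>a = d\<close>.\<close>

lemma last_poly_exponents:
  fixes p q d a :: nat
  assumes "d * q \<le> p" "a \<le> d"
  shows "d * (q * a + (p - d * q)) - p * a = (d - a) * (p - d * q)"
    and "p * a \<le> d * (q * a + (p - d * q))"
proof -
  obtain s where s: "p = d * q + s" using assms(1) le_Suc_ex by blast
  obtain b where b: "d = a + b" using assms(2) le_Suc_ex by blast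
  have "d * (q * a + (p - d * q)) = p * a + (d - a) * (p - d * q)"
    unfolding s using b by (simp add: algebra_simps)
  then show "d * (q * a + (p - d * q)) - p * a = (d - a) * (p - d * q)"
    and "p * a \<le> d * (q * a + (p - d * q))"
    by simp_all
qed

section \<open>The equations modulo a prime\<close>

context prime_ideal_set
begin

text \<open>The hypothesis says \<open>x j = u * v ^ j\<close> for \<open>u = x 0\<close> and
  \<open>v = x 1 / x 0\<close>, with denominators cleared; the factor \<open>x 0 ^ b\<close> clears
  that of \<open>v ^ b\<close>.\<close>

lemma uv_monomial_cong:
  assumes x: "\<And>j. j \<le> d \<Longrightarrow> x 0 ^ j * x j \<approx> x 0 * x 1 ^ j" and "b \<le> d * a" "d > 0"
  shows "x 0 ^ b * uv_monomial x d a b \<approx> x 0 ^ a * x 1 ^ b"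
proof (cases "b = d * a")
  case True
  have "x 0 ^ b * uv_monomial x d a b = (x 0 ^ d * x d) ^ a"
    by (simp add: uv_monomial_def True power_mult power_mult_distrib)
  also have "\<dots> \<approx> (x 0 * x 1 ^ d) ^ a" by (intro cong_power x) simp
  also have "(x 0 * x 1 ^ d) ^ a = x 0 ^ a * x 1 ^ b"
    by (simp add: True power_mult power_mult_distrib)
  finally show ?thesis .
next
  case False
  define k r where "k = b div d" and "r = b mod d"
  have b: "b = d * k + r" and r: "r < d" using assms(3) by (simp_all add: k_def r_def)
  \<comment> \<open>As \<open>b < d * a\<close>, the quotient \<open>k\<close> is below
    \<open>a\<close>, so the exponent \<open>a - k - 1\<close> of \<open>x 0\<close> is not
    truncated.\<close>
  have "k < a" using False assms(2) by (simp add: k_def div_less_iff_less_mult[OF assms(3)] mult.commute)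
  then obtain e where e: "a = Suc (k + e)" using less_natE by blast
  have "x 0 ^ b * uv_monomial x d a b = (x 0 ^ d * x d) ^ k * (x 0 ^ r * x r) * x 0 ^ e"
    using False unfolding uv_monomial_def k_def[symmetric] r_def[symmetric]
    by (simp add: b e power_add power_mult power_mult_distrib algebra_simps)
  also have "\<dots> \<approx> (x 0 * x 1 ^ d) ^ k * (x 0 * x 1 ^ r) * x 0 ^ e"
    using r by (intro cong_mult cong_power x) auto
  also have "(x 0 * x 1 ^ d) ^ k * (x 0 * x 1 ^ r) * x 0 ^ e = x 0 ^ a * x 1 ^ b"
    by (simp add: b e power_add power_mult power_mult_distrib algebra_simps)
  finally show ?thesis .
qed

text \<open>The identity \<open>scroll_poly x i = u * (x (i+1) - v * x i) ^ i\<close>, multiplied by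
  \<open>x 0 ^ i\<close>. Only relations up to index \<open>i\<close> enter, so an induction can use
  it to derive the next one.\<close>

lemma scroll_poly_cong:
  assumes x: "\<And>j. j \<le> i \<Longrightarrow> x 0 ^ j * x j \<approx> x 0 * x 1 ^ j"
  shows "x 0 ^ i * scroll_poly x i \<approx> x 0 * (x 0 * x (Suc i) - x 1 * x i) ^ i"
proof -
  have "x 0 ^ i * scroll_poly x i =
    (\<Sum>a\<le>i. (-1) ^ a * of_nat (i choose a) * (x 0 ^ a * x a) * x i ^ a * (x 0 * x (Suc i)) ^ (i - a))"
    unfolding scroll_poly_def sum_distrib_left
  proof (rule sum.cong)
    fix a assume "a \<in> {..i}"
    \<comment> \<open>The factor \<open>x 0 ^ a\<close> goes to \<open>x a\<close>, and the rest to
      the power of \<open>x (Suc i)\<close>.\<close>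
    then have "x 0 ^ i = x 0 ^ a * x 0 ^ (i - a)" by (simp flip: power_add)
    then show "x 0 ^ i * ((-1) ^ a * of_nat (i choose a) * (x a * x i ^ a * x (Suc i) ^ (i - a))) =
      (-1) ^ a * of_nat (i choose a) * (x 0 ^ a * x a) * x i ^ a * (x 0 * x (Suc i)) ^ (i - a)"
      by (simp add: power_mult_distrib algebra_simps)
  qed simp
  also have "\<dots> \<approx> (\<Sum>a\<le>i. (-1) ^ a * of_nat (i choose a) * (x 0 * x 1 ^ a) * x i ^ a
      * (x 0 * x (Suc i)) ^ (i - a))"
    by (intro cong_sum cong_mult x cong_refl) auto
  also have "(\<Sum>a\<le>i. (-1) ^ a * of_nat (i choose a) * (x 0 * x 1 ^ a) * x i ^ a
      * (x 0 * x (Suc i)) ^ (i - a)) = x 0 * (- (x 1 * x i) + x 0 * x (Suc i)) ^ i"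
  proof (subst binomial_ring, subst sum_distrib_left, rule sum.cong)
    fix a
    have "(- (x 1 * x i)) ^ a = (-1) ^ a * (x 1 ^ a * x i ^ a)"
      by (subst power_minus[of "x 1 * x i"], subst power_mult_distrib[of "x 1"]) simp
    then show "(-1) ^ a * of_nat (i choose a) * (x 0 * x 1 ^ a) * x i ^ a * (x 0 * x (Suc i)) ^ (i - a)
      = x 0 * (of_nat (i choose a) * (- (x 1 * x i)) ^ a * (x 0 * x (Suc i)) ^ (i - a))"
      by (simp only: ac_simps)
  qed simp
  finally show ?thesis by simp
qed

text \<open>The factor \<open>x 0 ^ (p * d)\<close> clears the denominator of \<open>v ^ p\<close>
  in each of the \<open>d\<close> factors \<open>u ^ q * v ^ p - w\<close>.\<close>

lemma last_poly_cong:
  assumes x: "\<And>j. j \<le> d \<Longrightarrow> x 0 ^ j * x j \<approx> x 0 * x 1 ^ j" and "d > 0" and pq: "d * q \<le> p"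
  shows "x 0 ^ (p * d) * last_poly x w d p q \<approx> x 0 ^ (p - d * q) * (x 0 ^ q * x 1 ^ p - x 0 ^ p * w) ^ d"
proof -
  let ?s = "p - d * q"
  let ?m = "\<lambda>a. uv_monomial x d (q * a + ?s) (p * a)"
  have "x 0 ^ (p * d) * last_poly x w d p q =
    (\<Sum>a\<le>d. of_nat (d choose a) * (x 0 ^ (p * a) * ?m a) * (- (x 0 ^ p * w)) ^ (d - a))"
    unfolding last_poly_def sum_distrib_left
  proof (rule sum.cong)
    fix a assume "a \<in> {..d}"
    then have "p * d = p * a + p * (d - a)" by (simp flip: distrib_left)
    then have "x 0 ^ (p * d) = x 0 ^ (p * a) * x 0 ^ (p * (d - a))"
      by (simp add: power_add)
    moreover have "(- (x 0 ^ p * w)) ^ (d - a) = x 0 ^ (p * (d - a)) * (- w) ^ (d - a)"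
      by (simp add: power_mult flip: power_mult_distrib)
    ultimately show "x 0 ^ (p * d) * (of_nat (d choose a) * ?m a * (- w) ^ (d - a)) =
       of_nat (d choose a) * (x 0 ^ (p * a) * ?m a) * (- (x 0 ^ p * w)) ^ (d - a)"
      by (simp add: algebra_simps)
  qed simp
  also have "\<dots> \<approx> (\<Sum>a\<le>d. of_nat (d choose a) * (x 0 ^ (q * a + ?s) * x 1 ^ (p * a))
      * (- (x 0 ^ p * w)) ^ (d - a))"
    by (intro cong_sum cong_mult uv_monomial_cong x cong_refl last_poly_exponents) (use assms in auto)
  also have "(\<Sum>a\<le>d. of_nat (d choose a) * (x 0 ^ (q * a + ?s) * x 1 ^ (p * a))
      * (- (x 0 ^ p * w)) ^ (d - a)) = x 0 ^ ?s * (x 0 ^ q * x 1 ^ p + - (x 0 ^ p * w)) ^ d"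
  proof -
    have "e * (x 0 ^ (q * a + ?s) * x 1 ^ (p * a)) * f = x 0 ^ ?s * (e * (x 0 ^ q * x 1 ^ p) ^ a * f)"
      for e f a
    proof -
      have "x 0 ^ (q * a + ?s) * x 1 ^ (p * a) = x 0 ^ ?s * (x 0 ^ q * x 1 ^ p) ^ a"
        unfolding power_add power_mult power_mult_distrib by (simp only: ac_simps)
      then show ?thesis by (simp only: ac_simps)
    qed
    then show ?thesis by (subst binomial_ring, subst sum_distrib_left) simp
  qed
  finally show ?thesis by simp
qed

text \<open>Modulo the relations up to \<open>i\<close>, the \<open>i\<close>-th equation is
  \<open>x 0\<close> times an \<open>i\<close>-th power. As \<open>x 0\<close> lies outside the
  prime, the base of that power lies in it, and this is the passage from \<open>x i\<close> to
  \<open>x (i+1)\<close>.\<close>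

lemma curve_relations:
  assumes x0: "x 0 \<notin> P" and g: "\<And>i. 1 \<le> i \<Longrightarrow> i < d \<Longrightarrow> scroll_poly x i \<in> P" and "j \<le> d"
  shows "x 0 ^ j * x j \<approx> x 0 * x 1 ^ j"
  using \<open>j \<le> d\<close>
proof (induction j rule: less_induct)
  case (less j)
  consider "j = 0" | "j = 1" | i where "j = Suc i" "1 \<le> i"
    by (metis One_nat_def Suc_leI not0_implies_Suc zero_less_iff_neq_zero)
  then show ?case
  proof cases
    case 3
    have IH: "x 0 ^ k * x k \<approx> x 0 * x 1 ^ k" if "k \<le> i" for k
      using less that 3 by simp
    have "x 0 ^ i * scroll_poly x i \<in> P"
      using g[of i] 3 less.prems mult_mem by simp
    then have "x 0 * (x 0 * x (Suc i) - x 1 * x i) ^ i \<in> P"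
      using cong_mem[OF scroll_poly_cong[OF IH]] by simp
    then have "x 0 * x (Suc i) \<approx> x 1 * x i"
      unfolding cong_def using x0 prime_mem power_memD by blast
    then have "x 0 ^ i * (x 0 * x (Suc i)) \<approx> x 0 ^ i * (x 1 * x i)"
      by (rule cong_mult[OF cong_refl])
    also have "x 0 ^ i * (x 1 * x i) = x 1 * (x 0 ^ i * x i)" by (simp add: algebra_simps)
    also have "\<dots> \<approx> x 1 * (x 0 * x 1 ^ i)" by (intro cong_mult cong_refl IH order_refl)
    finally show ?thesis using 3 by (simp add: algebra_simps)
  qed simp_all
qed

text \<open>Converse direction, needed to place the equations in the toric ideal. The case
  \<open>i = 0\<close> is excluded because \<open>scroll_poly x 0\<close> is
  \<open>x 0\<close>.\<close>

lemma scroll_poly_mem: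
  assumes x0: "x 0 \<notin> P" and x: "\<And>j. j \<le> Suc i \<Longrightarrow> x 0 ^ j * x j \<approx> x 0 * x 1 ^ j" and "i > 0"
  shows "scroll_poly x i \<in> P"
proof -
  have "x 0 ^ Suc i * x (Suc i) \<approx> x 1 * (x 0 * x 1 ^ i)"
    using x[of "Suc i"] by (simp add: algebra_simps)
  also have "\<dots> \<approx> x 1 * (x 0 ^ i * x i)" by (intro cong_mult cong_refl cong_sym[OF x]) simp
  finally have "x 0 ^ i * (x 0 * x (Suc i)) \<approx> x 0 ^ i * (x 1 * x i)" by (simp add: algebra_simps)
  then have "x 0 * x (Suc i) - x 1 * x i \<in> P"
    using cong_power_cancel[OF _ x0] by (simp add: cong_def)
  then have "x 0 * (x 0 * x (Suc i) - x 1 * x i) ^ i \<in> P"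
    using \<open>i > 0\<close> mult_mem power_mem by blast
  then have "x 0 ^ i * scroll_poly x i \<in> P"
    using cong_mem[OF scroll_poly_cong[of i x]] x by simp
  then show ?thesis using x0 prime_mem power_memD by blast
qed

lemma last_poly_mem:
  assumes x0: "x 0 \<notin> P" and x: "\<And>j. j \<le> d \<Longrightarrow> x 0 ^ j * x j \<approx> x 0 * x 1 ^ j"
    and "x 0 ^ q * x 1 ^ p \<approx> x 0 ^ p * w" and "d > 0" "d * q \<le> p"
  shows "last_poly x w d p q \<in> P"
proof -
  have "x 0 ^ (p - d * q) * (x 0 ^ q * x 1 ^ p - x 0 ^ p * w) ^ d \<in> P"
    using assms by (intro mult_mem power_mem) (auto simp: cong_def)
  then have "x 0 ^ (p * d) * last_poly x w d p q \<in> P"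
    using cong_mem[OF last_poly_cong[of d x q p w]] assms by simp
  then show ?thesis using x0 prime_mem power_memD by blast
qed

text \<open>Since \<open>x 0\<close> may be cancelled modulo \<open>P\<close>, both monomials can be
  evaluated at \<open>x j = u * v ^ j\<close>. The values differ by the factor
  \<open>(u ^ q * v ^ p) ^ t\<close>, and the last equation identifies \<open>u ^ q * v ^ p\<close>
  with \<open>w\<close>.\<close>

lemma monomial_relation_x0_notin:
  fixes x :: "nat \<Rightarrow> 'a" and A B :: "nat \<Rightarrow> nat"
  assumes x0: "x 0 \<notin> P" and "d > 0" "d * q \<le> p"
    and g: "\<And>i. 1 \<le> i \<Longrightarrow> i < d \<Longrightarrow> scroll_poly x i \<in> P" and D: "last_poly x w d p q \<in> P"
    and deg: "(\<Sum>j\<le>d. A j) = (\<Sum>j\<le>d. B j) + q * t"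
             "(\<Sum>j\<le>d. j * A j) = (\<Sum>j\<le>d. j * B j) + p * t"
  shows "(\<Prod>j\<le>d. x j ^ A j) \<approx> (\<Prod>j\<le>d. x j ^ B j) * w ^ t"
proof -
  have x: "x 0 ^ j * x j \<approx> x 0 * x 1 ^ j" if "j \<le> d" for j
    by (rule curve_relations[of x d, OF x0 _ that]) (rule g)
  have mono: "x 0 ^ (\<Sum>j\<le>d. j * C j) * (\<Prod>j\<le>d. x j ^ C j) \<approx> x 0 ^ (\<Sum>j\<le>d. C j) * x 1 ^ (\<Sum>j\<le>d. j * C j)"
    for C
  proof -
    have "x 0 ^ (\<Sum>j\<le>d. j * C j) * (\<Prod>j\<le>d. x j ^ C j) = (\<Prod>j\<le>d. (x 0 ^ j * x j) ^ C j)"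
      by (simp add: power_sum power_mult_distrib prod.distrib power_mult)
    also have "\<dots> \<approx> (\<Prod>j\<le>d. (x 0 * x 1 ^ j) ^ C j)"
      by (intro cong_prod cong_power x) auto
    also have "(\<Prod>j\<le>d. (x 0 * x 1 ^ j) ^ C j) = x 0 ^ (\<Sum>j\<le>d. C j) * x 1 ^ (\<Sum>j\<le>d. j * C j)"
      by (simp add: power_sum power_mult_distrib prod.distrib power_mult)
    finally show ?thesis .
  qed
  have "x 0 ^ (p - d * q) * (x 0 ^ q * x 1 ^ p - x 0 ^ p * w) ^ d \<in> P"
    using cong_mem[OF last_poly_cong[of d x q p w]] assms x mult_mem by simp
  then have rel: "x 0 ^ q * x 1 ^ p \<approx> x 0 ^ p * w"
    unfolding cong_def using x0 prime_mem power_memD by blast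
  let ?a = "\<Sum>j\<le>d. B j" and ?b = "\<Sum>j\<le>d. j * B j"
  have "x 0 ^ (?b + p * t) * (\<Prod>j\<le>d. x j ^ A j) \<approx> x 0 ^ (?a + q * t) * x 1 ^ (?b + p * t)"
    using mono[of A] deg by simp
  also have "x 0 ^ (?a + q * t) * x 1 ^ (?b + p * t) = (x 0 ^ ?a * x 1 ^ ?b) * (x 0 ^ q * x 1 ^ p) ^ t"
    by (simp add: power_add power_mult power_mult_distrib algebra_simps)
  also have "\<dots> \<approx> (x 0 ^ ?b * (\<Prod>j\<le>d. x j ^ B j)) * (x 0 ^ p * w) ^ t"
    by (intro cong_mult cong_power rel cong_sym[OF mono])
  also have "\<dots> = x 0 ^ (?b + p * t) * ((\<Prod>j\<le>d. x j ^ B j) * w ^ t)"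
    by (simp add: power_add power_mult power_mult_distrib algebra_simps)
  finally show ?thesis by (rule cong_power_cancel[OF _ x0])
qed

text \<open>Strictness of the inequality leaves a factor \<open>x (b mod d)\<close>, whose index is
  below \<open>d\<close>.\<close>

lemma uv_monomial_mem:
  assumes "\<And>j. j < d \<Longrightarrow> x j \<in> P" "b < d * a"
  shows "uv_monomial x d a b \<in> P"
proof -
  have "d > 0" using assms(2) by (cases d) auto
  then have "x (b mod d) \<in> P" using assms by simp
  then show ?thesis using assms(2) by (simp add: uv_monomial_def mult_mem mult_mem')
qed

text \<open>Induction on \<open>j\<close>: every term of \<open>scroll_poly x j\<close> but the last
  contains some \<open>x a\<close> with \<open>a < j\<close>, and the last one is
  \<open>x j ^ (j + 1)\<close> up to sign.\<close>

lemma scroll_variables_mem: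
  assumes x0: "x 0 \<in> P" and g: "\<And>i. 1 \<le> i \<Longrightarrow> i < d \<Longrightarrow> scroll_poly x i \<in> P" and "j < d"
  shows "x j \<in> P"
  using \<open>j < d\<close>
proof (induction j rule: less_induct)
  case (less j)
  show ?case
  proof (cases "j = 0")
    case False
    let ?f = "\<lambda>a. (-1) ^ a * of_nat (j choose a) * (x a * x j ^ a * x (Suc j) ^ (j - a))"
    have "scroll_poly x j = (\<Sum>a<j. ?f a) + (-1) ^ j * x j ^ Suc j"
      unfolding scroll_poly_def by (simp flip: lessThan_Suc_atMost)
    moreover have "(\<Sum>a<j. ?f a) \<in> P"
      using less by (intro sum_mem mult_mem mult_mem') auto
    moreover have "scroll_poly x j \<in> P" using g[of j] less.prems False by simp
    ultimately have "(-1) ^ j * x j ^ Suc j \<in> P"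
      using diff_mem[of "scroll_poly x j" "\<Sum>a<j. ?f a"] by simp
    then have "(-1) ^ j * ((-1) ^ j * x j ^ Suc j) \<in> P" by (rule mult_mem)
    then have "x j ^ Suc j \<in> P"
      by (simp only: mult.assoc[symmetric] power_add[symmetric]) (simp add: minus_one_power_iff)
    then show ?thesis by (rule power_memD)
  qed (simp add: x0)
qed

text \<open>The weight of \<open>x\<^sub>j\<close> is \<open>p - j * q\<close>, nonnegative, and a monomial of positive weight lies in \<open>P\<close>.\<close>
lemma monomial_relation_x0_mem:
  fixes x :: "nat \<Rightarrow> 'a" and A B :: "nat \<Rightarrow> nat"
  assumes x0: "x 0 \<in> P" and "d > 0" "d * q \<le> p" "p > 0"
    and g: "\<And>i. 1 \<le> i \<Longrightarrow> i < d \<Longrightarrow> scroll_poly x i \<in> P" and D: "last_poly x w d p q \<in> P"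
    and deg: "(\<Sum>j\<le>d. A j) = (\<Sum>j\<le>d. B j) + q * t"
             "(\<Sum>j\<le>d. j * A j) = (\<Sum>j\<le>d. j * B j) + p * t"
  shows "(\<Prod>j\<le>d. x j ^ A j) \<approx> (\<Prod>j\<le>d. x j ^ B j) * w ^ t"
proof -
  have xj: "x j \<in> P" if "j < d" for j
    by (rule scroll_variables_mem[of x d, OF x0 _ that]) (rule g)
  let ?s = "p - d * q"
  let ?f = "\<lambda>a. of_nat (d choose a) * uv_monomial x d (q * a + ?s) (p * a) * (- w) ^ (d - a)"
  \<comment> \<open>The total weight is \<open>p\<close> times the degree minus \<open>q\<close>
    times the exponent of \<open>v\<close>; it is stated additively to avoid truncated
    subtraction.\<close>
  have weight: "(\<Sum>j\<le>d. (p - j * q) * C j) + q * (\<Sum>j\<le>d. j * C j) = p * (\<Sum>j\<le>d. C j)" for C :: "nat \<Rightarrow> nat"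
    unfolding sum_distrib_left sum.distrib[symmetric]
  proof (rule sum.cong)
    fix j assume "j \<in> {..d}"
    then have "j * q \<le> p" using assms(3) by (meson atMost_iff le_trans mult_le_mono1)
    then have "(p - j * q) * C j + (j * q) * C j = p * C j" by (simp flip: distrib_right)
    then show "(p - j * q) * C j + q * (j * C j) = p * C j" by (simp add: algebra_simps)
  qed simp
  \<comment> \<open>The contributions \<open>p * q * t\<close> from the two degree conditions
    cancel.\<close>
  have weq: "(\<Sum>j\<le>d. (p - j * q) * A j) = (\<Sum>j\<le>d. (p - j * q) * B j)"
    using weight[of A] weight[of B] unfolding deg by (simp add: algebra_simps)
  have pos: "x j \<in> P" if "j \<le> d" "p - j * q > 0" for j
  proof (cases "j < d")
    case True then show ?thesis by (rule xj)
  next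
    case False
    then have j: "j = d" and s: "?s > 0" using that by auto
    \<comment> \<open>For \<open>p > d * q\<close> each term with \<open>a < d\<close> contains a
      variable of index below \<open>d\<close>, so the last equation leaves only
      \<open>x d ^ p\<close>.\<close>
    have "?f a \<in> P" if "a < d" for a
    proof -
      have "p * a < d * (q * a + ?s)"
      proof -
        have "0 < (d - a) * ?s" using s that by simp
        then have "0 < d * (q * a + ?s) - p * a"
          using last_poly_exponents(1)[OF assms(3), of a] that by simp
        then show ?thesis by (simp only: zero_less_diff)
      qed
      then show ?thesis using xj by (intro mult_mem mult_mem' uv_monomial_mem) auto
    qed
    then have "(\<Sum>a<d. ?f a) \<in> P" by (intro sum_mem) auto
    moreover have "last_poly x w d p q = (\<Sum>a<d. ?f a) + x d ^ p"
      using assms(3) unfolding last_poly_def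
      by (simp add: uv_monomial_def mult.commute flip: lessThan_Suc_atMost)
    ultimately have "x d ^ p \<in> P" using D diff_mem[of "last_poly x w d p q" "\<Sum>a<d. ?f a"] by simp
    then show ?thesis using j power_memD by simp
  qed
  have mem: "(\<Prod>j\<le>d. x j ^ C j) \<in> P" if "(\<Sum>j\<le>d. (p - j * q) * C j) > 0" for C
  proof -
    have "\<exists>j\<le>d. (p - j * q) * C j > 0"
      using that by (metis (no_types, lifting) atMost_iff not_gr0 sum.neutral)
    then obtain j where "j \<le> d" "(p - j * q) * C j > 0" by blast
    then show ?thesis using pos by (intro prod_mem[of _ j] power_mem) auto
  qed
  show ?thesis
  proof (cases "(\<Sum>j\<le>d. (p - j * q) * A j) > 0")
    case True
    then show ?thesis unfolding cong_def using mem[of A] mem[of B] weq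
      by (intro diff_mem mult_mem') auto
  next
    case False
    have zero: "C j = 0" if "(\<Sum>j\<le>d. (p - j * q) * C j) = 0" "j \<le> d" "j < d \<or> ?s > 0" for C :: "nat \<Rightarrow> nat" and j
    proof -
      have "(p - j * q) * C j = 0" using that by simp
      moreover have "p - j * q > 0"
      proof (cases "?s > 0")
        case True
        have "j * q \<le> d * q" using that by simp
        then show ?thesis using True by linarith
      next
        case False
        then have "j < d" "p = d * q" using that assms(3) by auto
        then show ?thesis using \<open>p > 0\<close> by simp
      qed
      ultimately show ?thesis by simp
    qed
    have wA: "(\<Sum>j\<le>d. (p - j * q) * A j) = 0" and wB: "(\<Sum>j\<le>d. (p - j * q) * B j) = 0"
      using False weq by auto
    show ?thesis
    proof (cases "?s > 0")
      case True
      \<comment> \<open>All weights are positive here, so both monomials are \<open>1\<close> and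
        the second degree condition forces \<open>t = 0\<close>.\<close>
      then have A: "A j = 0" and B: "B j = 0" if "j \<le> d" for j
        using zero[OF wA that] zero[OF wB that] by auto
      have "t = 0" using deg(2) A B \<open>p > 0\<close> by simp
      then show ?thesis using A B by simp
    next
      case s: False
      then have p: "p = d * q" using assms(3) by simp
      have A: "A j = 0" and B: "B j = 0" if "j < d" for j
        using zero[OF wA, of j] zero[OF wB, of j] that by auto
      have d: "{..d} = insert d {..<d}" by auto
      have Ad: "A d = B d + q * t" using deg(1) A B unfolding d by simp
      \<comment> \<open>For \<open>p = d * q\<close> every \<open>uv_monomial\<close> in the sum is
        a pure power of \<open>x d\<close>, and the sum is again a binomial expansion.\<close>
      have "last_poly x w d p q = (x d ^ q + - w) ^ d"
        unfolding last_poly_def binomial_ring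
        by (intro sum.cong) (simp_all add: p uv_monomial_def mult.assoc power_mult)
      then have "x d ^ q \<approx> w" using D power_memD by (simp add: cong_def)
      then have "x d ^ B d * (x d ^ q) ^ t \<approx> x d ^ B d * w ^ t"
        by (intro cong_mult cong_power cong_refl)
      then show ?thesis using A B unfolding d by (simp add: Ad power_add power_mult)
    qed
  qed
qed

lemma monomial_relation:
  fixes x :: "nat \<Rightarrow> 'a" and A B :: "nat \<Rightarrow> nat"
  assumes "d > 0" "d * q \<le> p" "p > 0"
    and "\<And>i. 1 \<le> i \<Longrightarrow> i < d \<Longrightarrow> scroll_poly x i \<in> P" and "last_poly x w d p q \<in> P"
    and "(\<Sum>j\<le>d. A j) = (\<Sum>j\<le>d. B j) + q * t"
        "(\<Sum>j\<le>d. j * A j) = (\<Sum>j\<le>d. j * B j) + p * t"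
  shows "(\<Prod>j\<le>d. x j ^ A j) \<approx> (\<Prod>j\<le>d. x j ^ B j) * w ^ t"
  using monomial_relation_x0_mem[where x = x and w = w and d = d and p = p and q = q and A = A and B = B and t = t]
    monomial_relation_x0_notin[where x = x and w = w and d = d and p = p and q = q and A = A and B = B and t = t] assms
  by blast

end

text \<open>By Zorn's lemma some ideal is maximal among those containing \<open>J\<close> and no
  power of \<open>f\<close>; maximality makes it prime. This is what describes radicals through
  primes.\<close>

lemma exists_prime_avoiding_powers:
  fixes J :: "'a::comm_ring_1 set"
  assumes J0: "0 \<in> J" and Ja: "\<And>a b. a \<in> J \<Longrightarrow> b \<in> J \<Longrightarrow> a + b \<in> J" and Jm: "\<And>a b. b \<in> J \<Longrightarrow> a * b \<in> J"
    and f: "\<And>k::nat. f ^ k \<notin> J"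
  obtains P where "prime_ideal_set P" "J \<subseteq> P" "f \<notin> P"
proof -
  define is_id where "is_id I \<longleftrightarrow> 0 \<in> I \<and> (\<forall>a\<in>I. \<forall>b\<in>I. a + b \<in> I) \<and> (\<forall>b\<in>I. \<forall>a. a * b \<in> I)" for I :: "'a set"
  define F where "F = {I. is_id I \<and> J \<subseteq> I \<and> (\<forall>k::nat. f ^ k \<notin> I)}"
  have JF: "J \<in> F" using assms by (auto simp: F_def is_id_def)
  have "\<exists>U\<in>F. \<forall>X\<in>C. X \<subseteq> U" if C: "subset.chain F C" for C
  proof (cases "C = {}")
    case True then show ?thesis using JF by auto
  next
    case False
    have CF: "C \<subseteq> F" and ch: "\<And>X Y. X \<in> C \<Longrightarrow> Y \<in> C \<Longrightarrow> X \<subseteq> Y \<or> Y \<subseteq> X"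
      using C by (auto simp: subset.chain_def)
    have "is_id (\<Union>C)"
      unfolding is_id_def
    proof (intro conjI ballI allI)
      show "0 \<in> \<Union>C" using False CF by (auto simp: F_def is_id_def)
    next
      fix a b assume "a \<in> \<Union>C" "b \<in> \<Union>C"
      then obtain X Y where XY: "X \<in> C" "Y \<in> C" "a \<in> X" "b \<in> Y" by auto
      then obtain Z where "Z \<in> C" "a \<in> Z" "b \<in> Z" using ch[of X Y] by blast
      then show "a + b \<in> \<Union>C" using CF unfolding F_def is_id_def by blast
    next
      fix b a assume "b \<in> \<Union>C"
      then show "a * b \<in> \<Union>C" using CF unfolding F_def is_id_def by blast
    qed
    then have "\<Union>C \<in> F" using False CF unfolding F_def by blast
    then show ?thesis by blast
  qed
  from subset_Zorn[OF this] obtain P where PF: "P \<in> F" and max: "\<And>X. X \<in> F \<Longrightarrow> P \<subseteq> X \<Longrightarrow> X = P"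
    by blast
  have P: "0 \<in> P" "\<And>a b. a \<in> P \<Longrightarrow> b \<in> P \<Longrightarrow> a + b \<in> P" "\<And>a b. b \<in> P \<Longrightarrow> a * b \<in> P" "J \<subseteq> P"
      "\<And>k. f ^ k \<notin> P"
    using PF by (auto simp: F_def is_id_def)
  \<comment> \<open>By maximality, adjoining \<open>a\<close> must produce a power of
    \<open>f\<close>. Multiplying two such representations then shows primality.\<close>
  have ext: "\<exists>k r. \<exists>s\<in>P. f ^ k = r * a + s" if a: "a \<notin> P" for a
  proof (rule ccontr)
    assume n: "\<not> ?thesis"
    define X where "X = {r * a + s |r s. s \<in> P}"
    have "is_id X" unfolding is_id_def
    proof (intro conjI ballI allI)
      show "0 \<in> X" unfolding X_def using P(1) by (auto intro!: exI[of _ 0])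
    next
      fix b c assume "b \<in> X" "c \<in> X"
      then obtain r s r' s' where "b = r * a + s" "c = r' * a + s'" "s \<in> P" "s' \<in> P"
        unfolding X_def by blast
      then have "b + c = (r + r') * a + (s + s')" "s + s' \<in> P" using P by (auto simp: algebra_simps)
      then show "b + c \<in> X" unfolding X_def by blast
    next
      fix b c assume "b \<in> X"
      then obtain r s where "b = r * a + s" "s \<in> P" unfolding X_def by blast
      then have "c * b = (c * r) * a + c * s" by (simp add: algebra_simps)
      moreover have "c * s \<in> P" using P(3) \<open>s \<in> P\<close> by blast
      ultimately show "c * b \<in> X" unfolding X_def by blast
    qed
    moreover have "P \<subseteq> X"
    proof
      fix s assume "s \<in> P"
      moreover have "s = 0 * a + s" by simp
      ultimately show "s \<in> X" unfolding X_def by blast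
    qed
    ultimately have "X \<in> F" using n P(4) unfolding F_def X_def by blast
    then have "X = P" using max \<open>P \<subseteq> X\<close> by blast
    moreover have "a = 1 * a + 0" by simp
    then have "a \<in> X" unfolding X_def using P(1) by blast
    ultimately show False using a by simp
  qed
  have "prime_ideal_set P"
  proof
    show "1 \<notin> P" using P(5)[of 0] by simp
  next
    fix a b assume ab: "a * b \<in> P"
    show "a \<in> P \<or> b \<in> P"
    proof (rule ccontr)
      assume "\<not> (a \<in> P \<or> b \<in> P)"
      then obtain k r s l r' s' where *: "s \<in> P" "f ^ k = r * a + s" "s' \<in> P" "f ^ l = r' * b + s'"
        using ext[of a] ext[of b] by blast
      have "f ^ (k + l) = (r * r') * (a * b) + (r * a) * s' + (r' * b + s') * s"
        unfolding power_add * by (simp add: algebra_simps)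
      also have "\<dots> \<in> P" by (rule P(2)[OF P(2)[OF P(3)[OF ab] P(3)[OF *(3)]] P(3)[OF *(1)]])
      finally show False using P(5) by blast
    qed
  qed (use P in auto)
  then show ?thesis using that P(4) P(5)[of 1] by simp
qed

section \<open>Toric ideals in polynomial rings\<close>

text \<open>One construction covers both the toric map (\<open>\<chi>\<close> constantly
  \<open>1\<close>) and \<open>retract\<close> (\<open>\<phi>\<close> the identity,
  \<open>\<chi>\<close> an indicator), so additivity and multiplicativity are shown once.\<close>

definition push_forward :: "('a \<Rightarrow> 'b) \<Rightarrow> ('a \<Rightarrow> 'k) \<Rightarrow> ('a \<Rightarrow>\<^sub>0 'k::comm_ring_1) \<Rightarrow> ('b \<Rightarrow>\<^sub>0 'k)" where
  "push_forward \<phi> \<chi> f = (\<Sum>\<alpha>\<in>Poly_Mapping.keys f. Poly_Mapping.single (\<phi> \<alpha>) (Poly_Mapping.lookup f \<alpha> * \<chi> \<alpha>))"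

lemma sum_monomials: "(\<Sum>\<alpha>\<in>Poly_Mapping.keys f. Poly_Mapping.single \<alpha> (Poly_Mapping.lookup f \<alpha>)) = f"
  by (rule poly_mapping_eqI)
    (auto simp: lookup_sum lookup_single when_def in_keys_iff)

lemma push_forward_superset:
  assumes "finite S" "Poly_Mapping.keys f \<subseteq> S"
  shows "push_forward \<phi> \<chi> f = (\<Sum>\<alpha>\<in>S. Poly_Mapping.single (\<phi> \<alpha>) (Poly_Mapping.lookup f \<alpha> * \<chi> \<alpha>))"
  unfolding push_forward_def
  by (rule sum.mono_neutral_left[OF assms]) (simp add: in_keys_iff)

lemma push_forward_single [simp]:
  "push_forward \<phi> \<chi> (Poly_Mapping.single a c) = Poly_Mapping.single (\<phi> a) (c * \<chi> a)"
  by (simp add: push_forward_superset[of "{a}"])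

lemma push_forward_zero [simp]: "push_forward \<phi> \<chi> 0 = 0"
  by (simp add: push_forward_def)

lemma push_forward_add: "push_forward \<phi> \<chi> (f + g) = push_forward \<phi> \<chi> f + push_forward \<phi> \<chi> g"
proof -
  have "Poly_Mapping.keys (f + g) \<subseteq> Poly_Mapping.keys f \<union> Poly_Mapping.keys g"
    by (rule Poly_Mapping.keys_add)
  then show ?thesis
    by (simp add: push_forward_superset[of "Poly_Mapping.keys f \<union> Poly_Mapping.keys g"] lookup_add
      single_add distrib_right sum.distrib)
qed

lemma push_forward_sum: "push_forward \<phi> \<chi> (sum f A) = (\<Sum>i\<in>A. push_forward \<phi> \<chi> (f i))"
  by (induction A rule: infinite_finite_induct) (auto simp: push_forward_add)

lemma push_forward_mult:
  fixes \<phi> :: "'a::comm_monoid_add \<Rightarrow> 'b::comm_monoid_add"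
  assumes "\<And>a b. \<phi> (a + b) = \<phi> a + \<phi> b" "\<And>a b. \<chi> (a + b) = \<chi> a * \<chi> b"
  shows "push_forward \<phi> \<chi> (f * g) = push_forward \<phi> \<chi> f * push_forward \<phi> \<chi> g"
proof -
  have "f * g = (\<Sum>a\<in>Poly_Mapping.keys f. \<Sum>b\<in>Poly_Mapping.keys g.
      Poly_Mapping.single (a + b) (Poly_Mapping.lookup f a * Poly_Mapping.lookup g b))"
    by (subst (1 2) sum_monomials[symmetric]) (simp add: sum_product mult_single)
  then have "push_forward \<phi> \<chi> (f * g) = (\<Sum>a\<in>Poly_Mapping.keys f. \<Sum>b\<in>Poly_Mapping.keys g.
      Poly_Mapping.single (\<phi> a + \<phi> b) (Poly_Mapping.lookup f a * Poly_Mapping.lookup g b * (\<chi> a * \<chi> b)))"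
    by (simp add: push_forward_sum assms)
  also have "\<dots> = push_forward \<phi> \<chi> f * push_forward \<phi> \<chi> g"
    unfolding push_forward_def sum_product mult_single by (simp add: ac_simps)
  finally show ?thesis .
qed

lemma lookup_mat_exp:
  assumes "finite S" "Poly_Mapping.keys \<alpha> \<subseteq> S"
  shows "Poly_Mapping.lookup (mat_exp m M \<alpha>) r = ((\<Sum>i\<in>S. M r i * int (Poly_Mapping.lookup \<alpha> i)) when r < m)"
proof -
  have "Poly_Mapping.lookup (mat_exp m M \<alpha>) r = (\<Sum>i\<in>Poly_Mapping.keys \<alpha>. M r i * int (Poly_Mapping.lookup \<alpha> i) when r < m)"
    unfolding mat_exp_def lookup_sum lookup_single by (intro sum.cong) (auto simp: when_def)
  also have "\<dots> = (\<Sum>i\<in>S. M r i * int (Poly_Mapping.lookup \<alpha> i) when r < m)"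
    using assms by (intro sum.mono_neutral_left) (auto simp: in_keys_iff)
  finally show ?thesis by (simp add: when_def)
qed

lemma mat_exp_add: "mat_exp m M (\<alpha> + \<beta>) = mat_exp m M \<alpha> + mat_exp m M \<beta>"
proof (rule poly_mapping_eqI)
  fix r
  have "Poly_Mapping.keys (\<alpha> + \<beta>) \<subseteq> Poly_Mapping.keys \<alpha> \<union> Poly_Mapping.keys \<beta>"
    by (rule Poly_Mapping.keys_add)
  then show "Poly_Mapping.lookup (mat_exp m M (\<alpha> + \<beta>)) r = Poly_Mapping.lookup (mat_exp m M \<alpha> + mat_exp m M \<beta>) r"
    by (simp add: lookup_add lookup_mat_exp[of "Poly_Mapping.keys \<alpha> \<union> Poly_Mapping.keys \<beta>"]
      distrib_left sum.distrib when_def)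
qed

lemma mat_exp_0 [simp]: "mat_exp m M 0 = 0"
  by (simp add: mat_exp_def)

lemma toric_map_eq_push_forward: "toric_map m M = push_forward (mat_exp m M) (\<lambda>_. 1)"
  by (simp add: fun_eq_iff toric_map_def push_forward_def)

lemma toric_map_single: "toric_map m M (Poly_Mapping.single \<alpha> c) = Poly_Mapping.single (mat_exp m M \<alpha>) c"
  by (simp add: toric_map_eq_push_forward)

definition toric_kernel :: "nat \<Rightarrow> (nat \<Rightarrow> nat \<Rightarrow> int) \<Rightarrow> 'k::field mpoly set" where
  "toric_kernel m M = {f. toric_map m M f = 0}"

text \<open>\<open>toric_map\<close> is a ring homomorphism into the Laurent polynomials, which have
  no zero divisors.\<close>

lemma prime_toric_kernel: "prime_ideal_set (toric_kernel m M :: 'k::field mpoly set)"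
proof
  have mult: "toric_map m M (f * g) = toric_map m M f * toric_map m M g" for f g :: "'k mpoly"
    unfolding toric_map_eq_push_forward by (intro push_forward_mult mat_exp_add) auto
  fix a b :: "'k mpoly"
  show "a * b \<in> toric_kernel m M" if "b \<in> toric_kernel m M"
    using that by (simp add: toric_kernel_def mult)
  show "a \<in> toric_kernel m M \<or> b \<in> toric_kernel m M" if "a * b \<in> toric_kernel m M"
    using that by (simp add: toric_kernel_def mult)
  show "1 \<notin> (toric_kernel m M :: 'k mpoly set)"
    using toric_map_single[of m M 0 "1 :: 'k"] by (simp add: toric_kernel_def)
qed (simp_all add: toric_kernel_def toric_map_eq_push_forward push_forward_add)

abbreviation monomial :: "'a \<Rightarrow> 'a \<Rightarrow>\<^sub>0 'k::field" where
  "monomial \<alpha> \<equiv> Poly_Mapping.single \<alpha> 1"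

lemma binomial_mem_toric_kernel:
  "(monomial \<alpha> - monomial \<beta> :: 'k::field mpoly) \<in> toric_kernel m M \<longleftrightarrow> mat_exp m M \<alpha> = mat_exp m M \<beta>"
proof -
  interpret prime_ideal_set "toric_kernel m M :: 'k mpoly set" by (rule prime_toric_kernel)
  have "toric_map m M (monomial \<alpha> - monomial \<beta> :: 'k mpoly) =
      monomial (mat_exp m M \<alpha>) - monomial (mat_exp m M \<beta>)"
    using push_forward_add[of "mat_exp m M" "\<lambda>_. 1" "monomial \<alpha> - monomial \<beta> :: 'k mpoly" "monomial \<beta>"]
    by (simp add: toric_map_eq_push_forward)
  moreover have "Poly_Mapping.lookup (monomial a - monomial b :: 'k lpoly) b \<noteq> 0" if "a \<noteq> b" for a b :: "nat \<Rightarrow>\<^sub>0 int"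
    using that by (simp add: lookup_minus lookup_single)
  then have "monomial a - monomial b \<noteq> (0 :: 'k lpoly)" if "a \<noteq> b" for a b :: "nat \<Rightarrow>\<^sub>0 int"
    using that by fastforce
  ultimately show ?thesis by (auto simp: toric_kernel_def)
qed

text \<open>The exponents of \<open>f\<close> are grouped by their image, each group with a
  representative \<open>rep\<close>. The coefficients in a group sum to zero, so replacing every
  exponent by its representative gives \<open>0\<close>; subtracting this from \<open>f\<close>
  leaves a combination of binomials.\<close>

lemma toric_kernel_spanned_by_binomials:
  fixes f :: "'k::field mpoly"
  assumes P: "prime_ideal_set Q" and f: "f \<in> toric_kernel m M"
    and bin: "\<And>\<alpha> \<beta>. \<alpha> \<in> Poly_Mapping.keys f \<Longrightarrow> \<beta> \<in> Poly_Mapping.keys f \<Longrightarrow> mat_exp m M \<alpha> = mat_exp m M \<beta>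
      \<Longrightarrow> monomial \<alpha> - monomial \<beta> \<in> Q"
  shows "f \<in> Q"
proof -
  interpret Q: prime_ideal_set Q by (rule P)
  let ?K = "Poly_Mapping.keys f" and ?e = "mat_exp m M"
  define rep where "rep \<delta> = (SOME \<alpha>. \<alpha> \<in> ?K \<and> ?e \<alpha> = \<delta>)" for \<delta>
  have rep: "rep (?e \<alpha>) \<in> ?K" "?e (rep (?e \<alpha>)) = ?e \<alpha>" if "\<alpha> \<in> ?K" for \<alpha>
    using someI[of "\<lambda>\<beta>. \<beta> \<in> ?K \<and> ?e \<beta> = ?e \<alpha>" \<alpha>] that unfolding rep_def by auto
  have coeff: "(\<Sum>\<alpha> | \<alpha> \<in> ?K \<and> ?e \<alpha> = \<delta>. Poly_Mapping.lookup f \<alpha>) = 0" for \<delta>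
  proof -
    have "0 = Poly_Mapping.lookup (toric_map m M f) \<delta>" using f by (simp add: toric_kernel_def)
    also have "\<dots> = (\<Sum>\<alpha>\<in>?K. Poly_Mapping.lookup f \<alpha> when ?e \<alpha> = \<delta>)"
      by (simp add: toric_map_def lookup_sum lookup_single)
    also have "\<dots> = (\<Sum>\<alpha> | \<alpha> \<in> ?K \<and> ?e \<alpha> = \<delta>. Poly_Mapping.lookup f \<alpha>)"
      by (intro sum.mono_neutral_cong_right) auto
    finally show ?thesis by simp
  qed
  have "(\<Sum>\<alpha>\<in>?K. Poly_Mapping.single (rep (?e \<alpha>)) (Poly_Mapping.lookup f \<alpha>)) =
      (\<Sum>\<delta>\<in>?e ` ?K. \<Sum>\<alpha> | \<alpha> \<in> ?K \<and> ?e \<alpha> = \<delta>. Poly_Mapping.single (rep (?e \<alpha>)) (Poly_Mapping.lookup f \<alpha>))"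
    by (rule sum.image_gen) simp
  also have "\<dots> = (\<Sum>\<delta>\<in>?e ` ?K. Poly_Mapping.single (rep \<delta>) (\<Sum>\<alpha> | \<alpha> \<in> ?K \<and> ?e \<alpha> = \<delta>. Poly_Mapping.lookup f \<alpha>))"
  proof (rule sum.cong)
    fix \<delta>
    have "Poly_Mapping.single b (sum g A) = (\<Sum>a\<in>A. Poly_Mapping.single b (g a))"
      for b :: "nat \<Rightarrow>\<^sub>0 nat" and g :: "(nat \<Rightarrow>\<^sub>0 nat) \<Rightarrow> 'k" and A
      by (induction A rule: infinite_finite_induct) (auto simp: single_add)
    then show "(\<Sum>\<alpha> | \<alpha> \<in> ?K \<and> ?e \<alpha> = \<delta>. Poly_Mapping.single (rep (?e \<alpha>)) (Poly_Mapping.lookup f \<alpha>)) =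
       Poly_Mapping.single (rep \<delta>) (\<Sum>\<alpha> | \<alpha> \<in> ?K \<and> ?e \<alpha> = \<delta>. Poly_Mapping.lookup f \<alpha>)" by simp
  qed simp
  finally have zero: "(\<Sum>\<alpha>\<in>?K. Poly_Mapping.single (rep (?e \<alpha>)) (Poly_Mapping.lookup f \<alpha>)) = 0"
    by (simp add: coeff)
  have "f = (\<Sum>\<alpha>\<in>?K. Poly_Mapping.single \<alpha> (Poly_Mapping.lookup f \<alpha>))
      - (\<Sum>\<alpha>\<in>?K. Poly_Mapping.single (rep (?e \<alpha>)) (Poly_Mapping.lookup f \<alpha>))"
    by (simp add: sum_monomials zero)
  also have "\<dots> = (\<Sum>\<alpha>\<in>?K. Poly_Mapping.single 0 (Poly_Mapping.lookup f \<alpha>) * (monomial \<alpha> - monomial (rep (?e \<alpha>))))"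
    by (simp add: sum_subtractf right_diff_distrib mult_single)
  also have "\<dots> \<in> Q"
    using rep bin by (intro Q.sum_mem Q.mult_mem) auto
  finally show ?thesis .
qed

section \<open>The polynomial ring in \<open>n\<close> variables and its ideals\<close>

lemma keys_add_nat:
  "Poly_Mapping.keys (\<alpha> + \<beta>) = Poly_Mapping.keys \<alpha> \<union> Poly_Mapping.keys (\<beta> :: nat \<Rightarrow>\<^sub>0 nat)"
  by (auto simp: in_keys_iff lookup_add)

lemma monomial_mem_poly_carrier: "Poly_Mapping.keys \<alpha> \<subseteq> {..<n} \<Longrightarrow> Poly_Mapping.single \<alpha> c \<in> poly_carrier n"
  by (simp add: poly_carrier_def)

lemma zero_mem_poly_carrier: "0 \<in> poly_carrier n"
  by (simp add: poly_carrier_def)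

lemma one_mem_poly_carrier: "1 \<in> poly_carrier n"
  using monomial_mem_poly_carrier[of 0 n 1] by simp

lemma add_mem_poly_carrier: "f \<in> poly_carrier n \<Longrightarrow> g \<in> poly_carrier n \<Longrightarrow> f + g \<in> poly_carrier n"
  using Poly_Mapping.keys_add[of f g] by (auto simp: poly_carrier_def)

lemma mult_mem_poly_carrier: "f \<in> poly_carrier n \<Longrightarrow> g \<in> poly_carrier n \<Longrightarrow> f * g \<in> poly_carrier n"
  unfolding poly_carrier_def using keys_mult[of f g] keys_add_nat by blast

lemma uminus_mem_poly_carrier: "f \<in> poly_carrier n \<Longrightarrow> - f \<in> poly_carrier n"
  by (auto simp: poly_carrier_def in_keys_iff)

lemma power_mem_poly_carrier: "f \<in> poly_carrier n \<Longrightarrow> f ^ k \<in> poly_carrier n"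
  by (induction k) (auto simp: one_mem_poly_carrier mult_mem_poly_carrier)

lemma sum_mem_poly_carrier: "(\<And>i. i \<in> A \<Longrightarrow> f i \<in> poly_carrier n) \<Longrightarrow> sum f A \<in> poly_carrier n"
  by (induction A rule: infinite_finite_induct) (auto simp: zero_mem_poly_carrier add_mem_poly_carrier)

lemma prod_mem_poly_carrier: "(\<And>i. i \<in> A \<Longrightarrow> f i \<in> poly_carrier n) \<Longrightarrow> prod f A \<in> poly_carrier n"
  by (induction A rule: infinite_finite_induct) (auto simp: one_mem_poly_carrier mult_mem_poly_carrier)

lemma of_nat_mem_poly_carrier: "of_nat k \<in> poly_carrier n"
  by (induction k) (auto simp: zero_mem_poly_carrier one_mem_poly_carrier add_mem_poly_carrier)

lemmas poly_carrier_closed = zero_mem_poly_carrier one_mem_poly_carrier add_mem_poly_carrier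
  mult_mem_poly_carrier uminus_mem_poly_carrier power_mem_poly_carrier sum_mem_poly_carrier
  prod_mem_poly_carrier of_nat_mem_poly_carrier

lemma polyR_simps [simp]:
  "carrier (polyR n) = poly_carrier n" "x \<otimes>\<^bsub>polyR n\<^esub> y = x * y" "\<one>\<^bsub>polyR n\<^esub> = 1"
  "\<zero>\<^bsub>polyR n\<^esub> = 0" "x \<oplus>\<^bsub>polyR n\<^esub> y = x + y"
  by (simp_all add: polyR_def)

lemma cring_polyR: "cring (polyR n :: 'k::field mpoly ring)"
proof (rule cringI)
  show "abelian_group (polyR n :: 'k mpoly ring)"
  proof (rule abelian_groupI)
    fix x :: "'k mpoly" assume "x \<in> carrier (polyR n)"
    then show "\<exists>y\<in>carrier (polyR n). y \<oplus>\<^bsub>polyR n\<^esub> x = \<zero>\<^bsub>polyR n\<^esub>"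
      by (intro bexI[of _ "-x"]) (auto simp: poly_carrier_closed)
  qed (auto simp: poly_carrier_closed ac_simps)
  show "Group.comm_monoid (polyR n :: 'k mpoly ring)"
    by (rule comm_monoidI) (auto simp: poly_carrier_closed ac_simps)
qed (auto simp: algebra_simps)

lemma polyR_power [simp]: "f [^]\<^bsub>polyR n\<^esub> (k::nat) = f ^ k"
  by (induction k) (auto simp: nat_pow_def ac_simps)

text \<open>This links the algebraic structure to type-class arithmetic. Negation comes for free, as
  multiplication by \<open>- 1\<close>.\<close>

lemma ideal_polyR_iff:
  "ideal I (polyR n) \<longleftrightarrow> I \<subseteq> poly_carrier n \<and> 0 \<in> I \<and> (\<forall>a\<in>I. \<forall>b\<in>I. a + b \<in> I)
     \<and> (\<forall>b\<in>I. \<forall>a\<in>poly_carrier n. a * b \<in> I)" (is "?L \<longleftrightarrow> ?R")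
proof
  assume ?L
  then interpret ideal I "polyR n" .
  show ?R
    using a_subset additive_subgroup.zero_closed[OF is_additive_subgroup]
      additive_subgroup.a_closed[OF is_additive_subgroup] I_l_closed by simp
next
  assume R: ?R
  have um: "- b \<in> I" if "b \<in> I" for b
  proof -
    have "(- 1) * b \<in> I" using R that uminus_mem_poly_carrier[OF one_mem_poly_carrier] by blast
    then show ?thesis by simp
  qed
  interpret cring "polyR n :: 'a mpoly ring" by (rule cring_polyR)
  show ?L
  proof (rule idealI)
    show "ring (polyR n :: 'a mpoly ring)" by (rule ring_axioms)
    have inv: "inv\<^bsub>add_monoid (polyR n)\<^esub> x = - x" if "x \<in> poly_carrier n" for x :: "'a mpoly"
      using minus_equality[of "-x" x] that by (simp add: poly_carrier_closed a_inv_def)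
    show "subgroup I (add_monoid (polyR n))"
      by (rule subgroup.intro) (use R um inv in \<open>auto simp: subset_iff\<close>)
  qed (use R in \<open>auto simp: mult.commute\<close>)
qed

text \<open>Setting the variables outside \<open>x\<^sub>0, \<dots>, x\<^bsub>n-1\<^esub>\<close> to zero is a retraction onto the carrier; it
  matches the prime ideals of \<^term>\<open>polyR n\<close> with prime ideals of the whole type.\<close>
definition retract :: "nat \<Rightarrow> 'k::field mpoly \<Rightarrow> 'k mpoly" where
  "retract n = push_forward id (\<lambda>\<alpha>. if Poly_Mapping.keys \<alpha> \<subseteq> {..<n} then 1 else 0)"

lemma retract_add: "retract n (f + g) = retract n f + retract n g"
  by (simp add: retract_def push_forward_add)

lemma retract_mult: "retract n (f * g) = retract n f * retract n g"
  unfolding retract_def by (rule push_forward_mult) (auto simp: keys_add_nat)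

lemma retract_id: "f \<in> poly_carrier n \<Longrightarrow> retract n f = f"
proof -
  assume "f \<in> poly_carrier n"
  then have "retract n f = (\<Sum>\<alpha>\<in>Poly_Mapping.keys f. Poly_Mapping.single \<alpha> (Poly_Mapping.lookup f \<alpha>))"
    unfolding retract_def push_forward_def by (intro sum.cong) (auto simp: poly_carrier_def)
  then show ?thesis by (simp add: sum_monomials)
qed

lemma retract_mem: "retract n f \<in> poly_carrier n"
  unfolding retract_def push_forward_def
  by (intro sum_mem_poly_carrier) (auto simp: monomial_mem_poly_carrier zero_mem_poly_carrier)

lemma ideal_retract_vimage:
  assumes "ideal I (polyR n)"
  shows "0 \<in> retract n -` I" "a \<in> retract n -` I \<Longrightarrow> b \<in> retract n -` I \<Longrightarrow> a + b \<in> retract n -` I"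
    "b \<in> retract n -` I \<Longrightarrow> a * b \<in> retract n -` I"
proof -
  have I: "0 \<in> I" "\<And>a b. a \<in> I \<Longrightarrow> b \<in> I \<Longrightarrow> a + b \<in> I"
    "\<And>a b. b \<in> I \<Longrightarrow> a \<in> poly_carrier n \<Longrightarrow> a * b \<in> I"
    using assms unfolding ideal_polyR_iff by blast+
  show "0 \<in> retract n -` I" using I(1) by (simp add: retract_id zero_mem_poly_carrier)
  show "a \<in> retract n -` I \<Longrightarrow> b \<in> retract n -` I \<Longrightarrow> a + b \<in> retract n -` I"
    using I(2) by (simp add: retract_add)
  show "b \<in> retract n -` I \<Longrightarrow> a * b \<in> retract n -` I"
    using I(3) by (simp add: retract_mult retract_mem)
qed

lemma prime_retract_vimage:
  assumes "primeideal I (polyR n)"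
  shows "prime_ideal_set (retract n -` I)"
proof -
  interpret I: primeideal I "polyR n" by (rule assms)
  note id = I.is_ideal[unfolded ideal_polyR_iff]
  show ?thesis
  proof
    show "1 \<notin> retract n -` I"
    proof
      assume "1 \<in> retract n -` I"
      then have "1 \<in> I" by (simp add: retract_id one_mem_poly_carrier)
      then have "I = poly_carrier n" using id by (metis mult.right_neutral subsetI subset_antisym)
      then show False using I.I_notcarr by simp
    qed
  next
    fix a b assume "a * b \<in> retract n -` I"
    then show "a \<in> retract n -` I \<or> b \<in> retract n -` I"
      using I.I_prime[of "retract n a" "retract n b"] by (simp add: retract_mult retract_mem)
  qed (use ideal_retract_vimage[OF I.is_ideal] in auto)
qed

text \<open>The direction opposite to \<open>prime_retract_vimage\<close>; it turns toric kernels
  into prime ideals of \<open>polyR n\<close>.\<close>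

lemma primeideal_Int_poly_carrier:
  assumes "prime_ideal_set P"
  shows "primeideal (P \<inter> poly_carrier n) (polyR n)"
proof -
  interpret P: prime_ideal_set P by (rule assms)
  show ?thesis
  proof (rule primeidealI)
    show "ideal (P \<inter> poly_carrier n) (polyR n)"
      by (auto simp: ideal_polyR_iff poly_carrier_closed P.zero_mem P.add_mem P.mult_mem)
    show "cring (polyR n :: 'a mpoly ring)" by (rule cring_polyR)
    show "carrier (polyR n) \<noteq> P \<inter> poly_carrier n"
      using P.one_notin one_mem_poly_carrier by auto
  qed (use P.prime_mem in auto)
qed

lemma toric_ideal_eq: "toric_ideal m n M = toric_kernel m M \<inter> poly_carrier n"
  by (auto simp: toric_ideal_def toric_kernel_def)

lemma primeideal_toric_ideal: "primeideal (toric_ideal m n M) (polyR n)"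
  unfolding toric_ideal_eq by (rule primeideal_Int_poly_carrier[OF prime_toric_kernel])

text \<open>If no power of an element of \<open>T\<close> lay in the generated ideal, a prime
  containing that ideal would omit the element, against the assumption on primes. Conversely
  \<open>T\<close> is prime and contains the generated ideal, hence its radical.\<close>

lemma radical_eqI:
  assumes gs: "G \<subseteq> T" and T: "primeideal T (polyR n)"
    and P: "\<And>P f. prime_ideal_set P \<Longrightarrow> G \<subseteq> P \<Longrightarrow> f \<in> T \<Longrightarrow> f \<in> P"
  shows "T = radical_of (polyR n) (genideal (polyR n) G)"
proof -
  interpret R: cring "polyR n :: 'a mpoly ring" by (rule cring_polyR)
  interpret T: primeideal T "polyR n" by (rule T)
  interpret T': prime_ideal_set "retract n -` T" by (rule prime_retract_vimage[OF T])
  let ?J = "genideal (polyR n) G"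
  have TC: "T \<subseteq> poly_carrier n" using T.a_subset by simp
  then have GC: "G \<subseteq> carrier (polyR n)" using gs by auto
  have J: "ideal ?J (polyR n)" "G \<subseteq> ?J"
    using R.genideal_ideal[OF GC] R.genideal_self[OF GC] by auto
  show ?thesis
  proof (intro equalityI subsetI)
    fix f assume f: "f \<in> T"
    have fC: "f \<in> poly_carrier n" using f TC by auto
    have "\<exists>k. f ^ k \<in> ?J"
    proof (rule ccontr)
      assume "\<not> ?thesis"
      then have "f ^ k \<notin> retract n -` ?J" for k
        by (simp add: retract_id power_mem_poly_carrier fC)
      from exists_prime_avoiding_powers[OF ideal_retract_vimage[OF J(1)] this]
      obtain P where "prime_ideal_set P" "retract n -` ?J \<subseteq> P" "f \<notin> P" by blast
      moreover have "G \<subseteq> retract n -` ?J" using J(2) gs TC by (auto simp: retract_id subset_iff)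
      ultimately show False using P[of P f] f by blast
    qed
    then show "f \<in> radical_of (polyR n) ?J" using fC by (auto simp: radical_of_def)
  next
    fix f assume "f \<in> radical_of (polyR n) ?J"
    then obtain k :: nat where "f \<in> poly_carrier n" "f ^ k \<in> ?J" by (auto simp: radical_of_def)
    then have "f ^ k \<in> T" using R.genideal_minimal[OF T.is_ideal gs] by auto
    then show "f \<in> T" using T'.power_memD[of f k] \<open>f \<in> poly_carrier n\<close>
      by (simp add: retract_id power_mem_poly_carrier)
  qed
qed

section \<open>Heights\<close>

definition box :: "nat set \<Rightarrow> nat \<Rightarrow> (nat \<Rightarrow>\<^sub>0 nat) set" where
  "box S E = {\<alpha>. Poly_Mapping.keys \<alpha> \<subseteq> S \<and> (\<forall>i. Poly_Mapping.lookup \<alpha> i \<le> E)}"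

lemma bij_betw_box:
  assumes "finite S"
  shows "bij_betw (\<lambda>\<alpha>. restrict (Poly_Mapping.lookup \<alpha>) S) (box S E) (PiE S (\<lambda>_. {..E}))"
proof (rule bij_betwI')
  fix \<alpha> \<beta> assume "\<alpha> \<in> box S E" "\<beta> \<in> box S E"
  then have out: "Poly_Mapping.lookup \<alpha> i = 0" "Poly_Mapping.lookup \<beta> i = 0" if "i \<notin> S" for i
    using that by (auto simp: box_def in_keys_iff)
  show "(restrict (Poly_Mapping.lookup \<alpha>) S = restrict (Poly_Mapping.lookup \<beta>) S) = (\<alpha> = \<beta>)"
  proof
    assume eq: "restrict (Poly_Mapping.lookup \<alpha>) S = restrict (Poly_Mapping.lookup \<beta>) S"
    show "\<alpha> = \<beta>"
    proof (rule poly_mapping_eqI)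
      fix i show "Poly_Mapping.lookup \<alpha> i = Poly_Mapping.lookup \<beta> i"
        using fun_cong[OF eq, of i] out[of i] by (cases "i \<in> S") auto
    qed
  qed simp
next
  fix \<alpha> assume "\<alpha> \<in> box S E"
  then show "restrict (Poly_Mapping.lookup \<alpha>) S \<in> PiE S (\<lambda>_. {..E})" by (auto simp: box_def)
next
  fix g assume g: "g \<in> PiE S (\<lambda>_. {..E})"
  define \<alpha> where "\<alpha> = Abs_poly_mapping (\<lambda>i. if i \<in> S then g i else 0)"
  have "finite {i. (if i \<in> S then g i else 0) \<noteq> 0}"
    by (rule finite_subset[OF _ assms]) auto
  then have lk: "Poly_Mapping.lookup \<alpha> i = (if i \<in> S then g i else 0)" for i
    by (simp add: \<alpha>_def)
  have "\<alpha> \<in> box S E" using g by (auto simp: box_def in_keys_iff lk PiE_iff split: if_splits)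
  moreover have "g = restrict (Poly_Mapping.lookup \<alpha>) S"
    using PiE_arb[OF g] by (intro ext) (simp add: lk)
  ultimately show "\<exists>\<alpha>\<in>box S E. g = restrict (Poly_Mapping.lookup \<alpha>) S" by blast
qed

lemma finite_box: "finite S \<Longrightarrow> finite (box S E)"
  using bij_betw_finite[OF bij_betw_box[of S E]] by (simp add: finite_PiE)

lemma card_box: "finite S \<Longrightarrow> card (box S E) = (E + 1) ^ card S"
  using bij_betw_same_card[OF bij_betw_box[of S E]] by (simp add: card_PiE)

lemma box_add: "\<alpha> \<in> box S E \<Longrightarrow> \<beta> \<in> box S F \<Longrightarrow> \<alpha> + \<beta> \<in> box S (E + F)"
  by (auto simp: box_def keys_add_nat lookup_add add_mono)

lemma box_mono: "S \<subseteq> T \<Longrightarrow> E \<le> F \<Longrightarrow> box S E \<subseteq> box T F"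
  by (auto simp: box_def intro: order_trans)

lemma keys_mult_box:
  assumes "Poly_Mapping.keys p \<subseteq> box S E" "Poly_Mapping.keys q \<subseteq> box S F"
  shows "Poly_Mapping.keys (p * q) \<subseteq> box S (E + F)"
  using keys_mult[of p q] box_add assms by blast

lemma keys_power_box:
  assumes "Poly_Mapping.keys p \<subseteq> box S E"
  shows "Poly_Mapping.keys (p ^ e) \<subseteq> box S (e * E)"
proof (induction e)
  case 0
  then show ?case by (simp add: box_def flip: single_one)
next
  case (Suc e)
  then show ?case using keys_mult_box[OF assms Suc] by simp
qed

lemma keys_subset_box:
  assumes "p \<in> poly_carrier n"
  obtains E where "Poly_Mapping.keys p \<subseteq> box {..<n} E"
proof -
  \<comment> \<open>Inserting \<open>0\<close> keeps the set nonempty, so that \<open>Max\<close> is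
    meaningful, and covers the variables that do not occur.\<close>
  let ?X = "insert 0 (\<Union>\<alpha>\<in>Poly_Mapping.keys p. Poly_Mapping.lookup \<alpha> ` Poly_Mapping.keys \<alpha>)"
  have fin: "finite ?X" by simp
  have "Poly_Mapping.lookup \<alpha> i \<le> Max ?X" if "\<alpha> \<in> Poly_Mapping.keys p" for \<alpha> i
  proof (cases "i \<in> Poly_Mapping.keys \<alpha>")
    case True then show ?thesis using that by (intro Max_ge[OF fin]) blast
  next
    case False then show ?thesis by (simp add: in_keys_iff)
  qed
  then have "Poly_Mapping.keys p \<subseteq> box {..<n} (Max ?X)"
    using assms by (auto simp: box_def poly_carrier_def)
  then show ?thesis by (rule that)
qed

text \<open>Linear independence over the field in the quotient by \<open>P\<close>. Indexed families
  keep the number \<open>K\<close> of elements explicit.\<close>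

definition indep_mod :: "'k::field mpoly set \<Rightarrow> nat \<Rightarrow> (nat \<Rightarrow> 'k mpoly) \<Rightarrow> bool" where
  "indep_mod P K b \<longleftrightarrow>
     (\<forall>c. (\<Sum>j<K. Poly_Mapping.single 0 (c j) * b j) \<in> P \<longrightarrow> (\<forall>j<K. c j = 0))"

lemma indep_modD: "indep_mod P K b \<Longrightarrow> (\<Sum>j<K. Poly_Mapping.single 0 (c j) * b j) \<in> P \<Longrightarrow> j < K \<Longrightarrow> c j = 0"
  by (auto simp: indep_mod_def)

lemma sum_lessThan_add: "(\<Sum>k<(a::nat) + b. g k) = (\<Sum>k<a. g k) + (\<Sum>k<b. g (a + k) :: 'a::comm_monoid_add)"
  by (induction b) (auto simp: ac_simps)

text \<open>The index \<open>k\<close> encodes a power of \<open>f\<close> and a member of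
  \<open>b\<close>. Modulo \<open>P'\<close> a relation reduces to its block with
  \<open>f ^ 0\<close>, whose coefficients therefore vanish; from the rest one factor
  \<open>f\<close> cancels since \<open>P\<close> is prime, and induction on \<open>N\<close>
  applies.\<close>

lemma indep_mod_powers:
  assumes P: "prime_ideal_set P" and P': "prime_ideal_set P'" and sub: "P \<subseteq> P'"
    and f: "f \<in> P'" "f \<notin> P" and b: "indep_mod P' K b"
  shows "indep_mod P (N * K) (\<lambda>k. f ^ (k div K) * b (k mod K))"
proof -
  interpret P: prime_ideal_set P by (rule P)
  interpret P': prime_ideal_set P' by (rule P')
  show ?thesis
  proof (cases "K = 0")
    case False
    show ?thesis
    proof (induction N)
      case (Suc N)
      show ?case unfolding indep_mod_def
      proof (intro allI impI)
        fix c j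
        let ?t = "\<lambda>c k. Poly_Mapping.single 0 (c k) * (f ^ (k div K) * b (k mod K))"
        let ?s = "\<Sum>k<N * K. ?t (\<lambda>k. c (K + k)) k"
        assume mem: "(\<Sum>k<Suc N * K. ?t c k) \<in> P" and j: "j < Suc N * K"
        have split: "(\<Sum>k<Suc N * K. ?t c k) = (\<Sum>k<K. Poly_Mapping.single 0 (c k) * b k) + f * ?s"
          using False by (simp add: sum_lessThan_add sum_distrib_left ac_simps)
        have "(\<Sum>k<K. Poly_Mapping.single 0 (c k) * b k) = (\<Sum>k<Suc N * K. ?t c k) - f * ?s"
          unfolding split by simp
        also have "\<dots> \<in> P'" using mem sub f(1) by (intro P'.diff_mem P'.mult_mem') auto
        finally have c0: "c k = 0" if "k < K" for k using indep_modD[OF b] that by blast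
        then have "f * ?s \<in> P" using mem unfolding split by simp
        then have "?s \<in> P" using f(2) P.prime_mem by blast
        then have c1: "c (K + k) = 0" if "k < N * K" for k
          using indep_modD[OF Suc, of "\<lambda>k. c (K + k)"] that by blast
        show "c j = 0"
        proof (cases "j < K")
          case False
          then have "j = K + (j - K)" "j - K < N * K" using j by auto
          then show ?thesis using c1[of "j - K"] by simp
        qed (rule c0)
      qed
    qed (simp add: indep_mod_def)
  qed (simp add: indep_mod_def)
qed

text \<open>Independence modulo \<open>P\<close> implies independence of the polynomials themselves,
  which lie in the span of the monomials with exponents in \<open>X\<close>.\<close>

lemma indep_mod_card_le:
  fixes b :: "nat \<Rightarrow> 'k::field mpoly"
  assumes b: "indep_mod P K b" and "0 \<in> P" and X: "finite X" "\<And>j. j < K \<Longrightarrow> Poly_Mapping.keys (b j) \<subseteq> X"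
  shows "K \<le> card X"
proof -
  let ?scale = "\<lambda>(c::'k) (p::'k mpoly). Poly_Mapping.single 0 c * p"
  interpret vs: vector_space ?scale
  proof
    show "?scale a (?scale b x) = ?scale (a * b) x" for a b x
      by (simp add: mult_single flip: mult.assoc)
  qed (simp_all add: distrib_left distrib_right single_add)
  have inj: "inj_on b {..<K}"
  proof (rule inj_onI, rule ccontr)
    fix i j assume ij: "i \<in> {..<K}" "j \<in> {..<K}" "b i = b j" "i \<noteq> j"
    \<comment> \<open>A repeated member of the family would give a relation with coefficients
      \<open>1\<close> and \<open>-1\<close>.\<close>
    let ?c = "\<lambda>k. (if k = i then 1 else 0) - (if k = j then 1 else 0) :: 'k"
    have "(\<Sum>k<K. ?scale (if k = i then 1 else 0) (b k)) = b i" if "i < K" for i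
    proof -
      have "(\<Sum>k<K. ?scale (if k = i then 1 else 0) (b k)) = (\<Sum>k<K. if k = i then b k else 0)"
        by (intro sum.cong) auto
      then show ?thesis using that by simp
    qed
    then have "(\<Sum>k<K. ?scale (?c k) (b k)) = 0"
      using ij by (simp add: single_diff left_diff_distrib sum_subtractf)
    then have "?c i = 0" using indep_modD[OF b, of ?c i] \<open>0 \<in> P\<close> ij by simp
    then show False using ij by simp
  qed
  have "vs.independent (b ` {..<K})"
  proof
    assume "vs.dependent (b ` {..<K})"
    then obtain u where u: "\<exists>v\<in>b ` {..<K}. u v \<noteq> 0" "(\<Sum>v\<in>b ` {..<K}. ?scale (u v) v) = 0"
      by (auto simp: vs.dependent_finite)
    then have "(\<Sum>j<K. ?scale (u (b j)) (b j)) = 0" by (simp add: sum.reindex[OF inj])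
    then show False using indep_modD[OF b, of "\<lambda>j. u (b j)"] \<open>0 \<in> P\<close> u(1) by auto
  qed
  moreover have "p \<in> vs.span (monomial ` X)" if "Poly_Mapping.keys p \<subseteq> X" for p
  proof -
    have "(\<Sum>\<alpha>\<in>Poly_Mapping.keys p. ?scale (Poly_Mapping.lookup p \<alpha>) (monomial \<alpha>)) \<in> vs.span (monomial ` X)"
      using that by (intro vs.span_sum vs.span_scale vs.span_base) auto
    then show ?thesis by (simp add: mult_single sum_monomials)
  qed
  ultimately have "card (b ` {..<K}) \<le> card (monomial ` X :: 'k mpoly set)"
    using vs.independent_span_bound[of "monomial ` X" "b ` {..<K}"] X by blast
  also have "\<dots> \<le> card X" by (rule card_image_le[OF X(1)])
  finally show ?thesis by (simp add: card_image[OF inj])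
qed

text \<open>A lower bound for the growth of the Hilbert function of \<open>K[x\<^sub>0, \<dots>, x\<^bsub>n-1\<^esub>] / P\<close>; such a
  \<open>k\<close> is at most the dimension.\<close>
definition has_growth :: "'k::field mpoly set \<Rightarrow> nat \<Rightarrow> nat \<Rightarrow> bool" where
  "has_growth P n k \<longleftrightarrow> (\<exists>D. \<forall>N. \<exists>b. (\<forall>j<(N + 1) ^ k. Poly_Mapping.keys (b j) \<subseteq> box {..<n} (D * N))
     \<and> indep_mod P ((N + 1) ^ k) b)"

text \<open>Multiplying a family independent modulo \<open>P'\<close> by \<open>f ^ 0\<close>, ...,
  \<open>f ^ N\<close> gains a factor \<open>N + 1\<close> in size, while the exponents grow by at
  most \<open>E * N\<close>.\<close>

lemma has_growth_Suc:
  assumes P: "prime_ideal_set P" "prime_ideal_set P'" "P \<subseteq> P'"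
    and f: "f \<in> P'" "f \<notin> P" "f \<in> poly_carrier n" and gr: "has_growth P' n k"
  shows "has_growth P n (Suc k)"
proof -
  obtain E where E: "Poly_Mapping.keys f \<subseteq> box {..<n} E" using keys_subset_box[OF f(3)] .
  obtain D where D: "\<And>N. \<exists>b. (\<forall>j<(N + 1) ^ k. Poly_Mapping.keys (b j) \<subseteq> box {..<n} (D * N))
     \<and> indep_mod P' ((N + 1) ^ k) b" using gr unfolding has_growth_def by blast
  show ?thesis unfolding has_growth_def
  proof (intro exI[of _ "E + D"] allI)
    fix N :: nat
    let ?K = "(N + 1) ^ k"
    obtain b where b: "\<And>j. j < ?K \<Longrightarrow> Poly_Mapping.keys (b j) \<subseteq> box {..<n} (D * N)" "indep_mod P' ?K b"
      using D by blast
    let ?b = "\<lambda>j. f ^ (j div ?K) * b (j mod ?K)"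
    have "Poly_Mapping.keys (?b j) \<subseteq> box {..<n} ((E + D) * N)" if "j < (N + 1) ^ Suc k" for j
    proof -
      have "j div ?K < N + 1" using that by (simp add: less_mult_imp_div_less)
      then have "(j div ?K) * E + D * N \<le> (E + D) * N"
        by (simp add: distrib_right mult.commute[of E])
      moreover have "Poly_Mapping.keys (?b j) \<subseteq> box {..<n} ((j div ?K) * E + D * N)"
        by (intro keys_mult_box keys_power_box E b) simp
      ultimately show ?thesis using box_mono by blast
    qed
    moreover have "indep_mod P ((N + 1) ^ Suc k) ?b"
      using indep_mod_powers[OF P f(1,2) b(2), of "N + 1"] by simp
    ultimately show "\<exists>b. (\<forall>j<(N + 1) ^ Suc k. Poly_Mapping.keys (b j) \<subseteq> box {..<n} ((E + D) * N))
        \<and> indep_mod P ((N + 1) ^ Suc k) b" by (intro exI[of _ ?b]) blast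
  qed
qed

text \<open>The available monomials number \<open>(D * N + 1) ^ n\<close>, of order
  \<open>N ^ n\<close>, which is too few for \<open>(N + 1) ^ (n + 1)\<close> independent elements
  when \<open>N\<close> is large.\<close>

lemma has_growth_le:
  assumes "has_growth P n k" "0 \<in> P"
  shows "k \<le> n"
proof (rule ccontr)
  assume k: "\<not> k \<le> n"
  obtain D where D: "\<And>N. \<exists>b. (\<forall>j<(N + 1) ^ k. Poly_Mapping.keys (b j) \<subseteq> box {..<n} (D * N))
     \<and> indep_mod P ((N + 1) ^ k) b" using assms(1) unfolding has_growth_def by blast
  \<comment> \<open>With this value \<open>((D + 1) * (N + 1)) ^ n = N * (N + 1) ^ n\<close>,
    strictly below \<open>(N + 1) ^ (n + 1)\<close>.\<close>
  define N where "N = (D + 1) ^ n"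
  obtain b where b: "\<And>j. j < (N + 1) ^ k \<Longrightarrow> Poly_Mapping.keys (b j) \<subseteq> box {..<n} (D * N)"
    "indep_mod P ((N + 1) ^ k) b" using D by blast
  have "(N + 1) ^ Suc n \<le> (N + 1) ^ k" using k by (intro power_increasing) auto
  also have "\<dots> \<le> card (box {..<n} (D * N))"
    by (rule indep_mod_card_le[OF b(2) assms(2) finite_box b(1)]) auto
  also have "\<dots> = (D * N + 1) ^ n" by (simp add: card_box)
  also have "\<dots> \<le> ((D + 1) * (N + 1)) ^ n" by (intro power_mono) auto
  also have "\<dots> = N * (N + 1) ^ n" by (simp only: power_mult_distrib N_def)
  finally show False by simp
qed

text \<open>Distinct monomials in the variables of \<open>S\<close> have distinct Laurent monomials
  as images, so those in a box are independent modulo the toric ideal.\<close>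

lemma toric_has_growth:
  assumes S: "S \<subseteq> {..<n}" and inj: "inj_on (mat_exp m M) {\<alpha>. Poly_Mapping.keys \<alpha> \<subseteq> S}"
  shows "has_growth (retract n -` toric_ideal m n M :: 'k::field mpoly set) n (card S)"
  unfolding has_growth_def
proof (intro exI[of _ 1] allI)
  fix N :: nat
  let ?K = "(N + 1) ^ card S"
  have fin: "finite S" using S finite_subset by blast
  have "?K = card (box S N)" by (simp add: card_box fin)
  then obtain h where h: "bij_betw h {..<?K} (box S N)"
    using ex_bij_betw_nat_finite[OF finite_box[OF fin, of N]] by (auto simp: atLeast0LessThan)
  have hb: "h j \<in> box S N" if "j < ?K" for j using h that by (auto simp: bij_betw_def)
  let ?b = "\<lambda>j. monomial (h j) :: 'k mpoly"
  have keys: "Poly_Mapping.keys (?b j) \<subseteq> box {..<n} (1 * N)" if "j < ?K" for j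
    using hb[OF that] box_mono[OF S, of N N] by auto
  moreover have "indep_mod (retract n -` toric_ideal m n M) ?K ?b"
    unfolding indep_mod_def
  proof (intro allI impI)
    fix c j assume mem: "(\<Sum>j<?K. Poly_Mapping.single 0 (c j) * ?b j) \<in> retract n -` toric_ideal m n M"
      and j: "j < ?K"
    let ?s = "\<Sum>j<?K. Poly_Mapping.single (h j) (c j)"
    have sC: "?s \<in> poly_carrier n"
      using hb S by (intro sum_mem_poly_carrier monomial_mem_poly_carrier) (auto simp: box_def)
    then have "?s \<in> toric_kernel m M"
      using mem by (simp add: mult_single retract_id toric_ideal_eq)
    then have "0 = toric_map m M ?s" by (simp add: toric_kernel_def)
    also have "\<dots> = (\<Sum>i<?K. Poly_Mapping.single (mat_exp m M (h i)) (c i))"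
      by (simp add: toric_map_eq_push_forward push_forward_sum)
    finally have "0 = Poly_Mapping.lookup (\<Sum>i<?K. Poly_Mapping.single (mat_exp m M (h i)) (c i)) (mat_exp m M (h j))"
      by (metis lookup_zero)
    also have "\<dots> = (\<Sum>i<?K. c i when mat_exp m M (h i) = mat_exp m M (h j))"
      by (simp add: lookup_sum lookup_single)
    also have "\<dots> = (\<Sum>i<?K. if i = j then c i else 0)"
    proof (rule sum.cong)
      fix i assume "i \<in> {..<?K}"
      then have i: "i < ?K" by simp
      have "mat_exp m M (h i) = mat_exp m M (h j) \<longleftrightarrow> h i = h j"
        using inj_on_eq_iff[OF inj, of "h i" "h j"] hb[OF i] hb[OF j] by (auto simp: box_def)
      also have "\<dots> \<longleftrightarrow> i = j"
        using inj_on_eq_iff[OF bij_betw_imp_inj_on[OF h], of i j] i j by simp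
      finally show "(c i when mat_exp m M (h i) = mat_exp m M (h j)) = (if i = j then c i else 0)"
        by (simp add: when_def)
    qed simp
    also have "\<dots> = c j" using j by simp
    finally show "c j = 0" by simp
  qed
  ultimately show "\<exists>b::nat \<Rightarrow> 'k mpoly. (\<forall>j<?K. Poly_Mapping.keys (b j) \<subseteq> box {..<n} (1 * N)) \<and>
     indep_mod (retract n -` toric_ideal m n M) ?K b" by (intro exI[of _ ?b]) blast
qed

text \<open>Descending a chain of length \<open>l\<close> from \<open>P\<close>, each strict
  inclusion raises the growth exponent by one, whence \<open>k + l \<le> n\<close>.\<close>

lemma prime_height_le:
  assumes gr: "has_growth (retract n -` P) n k"
  shows "prime_height (polyR n) P \<le> enat (n - k)"
  unfolding prime_height_def
proof (rule SUP_least, clarify)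
  fix l Q
  assume Q: "\<forall>i\<le>l. primeideal (Q i) (polyR n)" "\<forall>i<l. Q i \<subset> Q (Suc i)" "P = Q l"
  have prime: "prime_ideal_set (retract n -` Q i)" if "i \<le> l" for i
    using prime_retract_vimage Q(1) that by blast
  have "has_growth (retract n -` Q (l - i)) n (k + i)" if "i \<le> l" for i
    using that
  proof (induction i)
    case 0
    then show ?case using gr Q(3) by simp
  next
    case (Suc i)
    let ?j = "l - Suc i"
    have j: "l - i = Suc ?j" "?j < l" using Suc.prems by auto
    obtain f where f: "f \<in> Q (l - i)" "f \<notin> Q ?j" using Q(2) j by fastforce
    interpret R: primeideal "Q (l - i)" "polyR n" using Q(1) by simp
    have fC: "f \<in> poly_carrier n" using f(1) R.a_subset by auto
    have "has_growth (retract n -` Q ?j) n (Suc (k + i))"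
    proof (rule has_growth_Suc)
      show "retract n -` Q ?j \<subseteq> retract n -` Q (l - i)" using Q(2) j by (intro vimage_mono) (metis psubset_imp_subset)
      show "f \<in> retract n -` Q (l - i)" "f \<notin> retract n -` Q ?j" using f fC by (auto simp: retract_id)
    qed (use prime fC Suc in auto)
    then show ?case by simp
  qed
  from this[of l] have "has_growth (retract n -` Q 0) n (k + l)" by simp
  then have "k + l \<le> n" by (rule has_growth_le) (rule prime_ideal_set.zero_mem[OF prime], simp)
  then show "enat l \<le> enat (n - k)" by simp
qed

text \<open>Any other prime above \<open>I\<close> prolongs each chain ending in \<open>I\<close> by
  one member, so the infimum is attained at \<open>I\<close> itself.\<close>

lemma ideal_height_primeideal:
  assumes "primeideal I R"
  shows "ideal_height R I = prime_height R I"
proof (rule antisym)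
  show "ideal_height R I \<le> prime_height R I"
    unfolding ideal_height_def using assms by (intro INF_lower) auto
  show "prime_height R I \<le> ideal_height R I"
    unfolding ideal_height_def
  proof (rule INF_greatest)
    fix P assume P: "P \<in> {P. primeideal P R \<and> I \<subseteq> P}"
    show "prime_height R I \<le> prime_height R P"
    proof (cases "P = I")
      case False
      show ?thesis unfolding prime_height_def[of R I]
      proof (rule SUP_least, clarify)
        fix l Q assume Q: "\<forall>i\<le>l. primeideal (Q i) R" "\<forall>i<l. Q i \<subset> Q (Suc i)" "I = Q l"
        let ?Q = "Q(Suc l := P)"
        have "\<forall>i\<le>Suc l. primeideal (?Q i) R" "\<forall>i<Suc l. ?Q i \<subset> ?Q (Suc i)" "?Q (Suc l) = P"
          using Q P False by (auto simp: le_Suc_eq less_Suc_eq)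
        then have "enat (Suc l) \<le> prime_height R P"
          unfolding prime_height_def by (intro SUP_upper) blast
        then show "enat l \<le> prime_height R P" by (rule order_trans[rotated]) simp
      qed
    qed simp
  qed
qed

text \<open>Since binomials span a toric ideal, it suffices to compare which exponents are
  identified.\<close>

lemma toric_ideal_mono:
  assumes "\<And>\<alpha> \<beta>. Poly_Mapping.keys \<alpha> \<subseteq> {..<n} \<Longrightarrow> Poly_Mapping.keys \<beta> \<subseteq> {..<n} \<Longrightarrow>
    mat_exp m M \<alpha> = mat_exp m M \<beta> \<Longrightarrow> mat_exp m' M' \<alpha> = mat_exp m' M' \<beta>"
  shows "(toric_ideal m n M :: 'k::field mpoly set) \<subseteq> toric_ideal m' n M'"
proof
  fix f :: "'k mpoly" assume f: "f \<in> toric_ideal m n M"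
  then have ker: "f \<in> toric_kernel m M" and keys: "\<And>\<alpha>. \<alpha> \<in> Poly_Mapping.keys f \<Longrightarrow> Poly_Mapping.keys \<alpha> \<subseteq> {..<n}"
    by (auto simp: toric_ideal_eq poly_carrier_def)
  have "f \<in> toric_kernel m' M'"
  proof (rule toric_kernel_spanned_by_binomials[OF prime_toric_kernel ker])
    fix \<alpha> \<beta> assume "\<alpha> \<in> Poly_Mapping.keys f" "\<beta> \<in> Poly_Mapping.keys f" "mat_exp m M \<alpha> = mat_exp m M \<beta>"
    then show "monomial \<alpha> - monomial \<beta> \<in> toric_kernel m' M'"
      using assms keys by (simp add: binomial_mem_toric_kernel)
  qed
  then show "f \<in> toric_ideal m' n M'" using f by (simp add: toric_ideal_eq)
qed

section \<open>The matrix of the theorem\<close>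

definition poly_var :: "nat \<Rightarrow> 'k::field mpoly" where
  "poly_var i = monomial (Poly_Mapping.single i 1)"

lemma poly_var_power: "(poly_var i ^ k :: 'k::field mpoly) = monomial (Poly_Mapping.single i k)"
  by (induction k) (simp_all add: poly_var_def mult_single flip: single_add)

lemma monomial_sum: "finite A \<Longrightarrow> (monomial (\<Sum>i\<in>A. f i) :: 'k::field mpoly) = (\<Prod>i\<in>A. monomial (f i))"
proof (induction A rule: finite_induct)
  case (insert x F)
  have "(monomial (f x + sum f F) :: 'k mpoly) = monomial (f x) * monomial (sum f F)"
    by (simp add: mult_single)
  then show ?case using insert by simp
qed simp

lemma monomial_nonzero: "monomial a \<noteq> (0 :: 'a \<Rightarrow>\<^sub>0 'k::field)"
  by (metis lookup_single_eq lookup_zero zero_neq_one)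

lemma monomial_eq_prod:
  assumes "Poly_Mapping.keys \<alpha> \<subseteq> {..<n}"
  shows "(monomial \<alpha> :: 'k::field mpoly) = (\<Prod>i<n. poly_var i ^ Poly_Mapping.lookup \<alpha> i)"
proof -
  have "\<alpha> = (\<Sum>i<n. Poly_Mapping.single i (Poly_Mapping.lookup \<alpha> i))"
  proof (rule poly_mapping_eqI)
    fix k
    have "k \<notin> {..<n} \<Longrightarrow> Poly_Mapping.lookup \<alpha> k = 0" using assms by (auto simp: in_keys_iff)
    then show "Poly_Mapping.lookup \<alpha> k =
        Poly_Mapping.lookup (\<Sum>i<n. Poly_Mapping.single i (Poly_Mapping.lookup \<alpha> i)) k"
      by (auto simp: lookup_sum lookup_single when_def)
  qed
  then have "(monomial \<alpha> :: 'k mpoly) = monomial (\<Sum>i<n. Poly_Mapping.single i (Poly_Mapping.lookup \<alpha> i))"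
    by (rule arg_cong)
  then show ?thesis by (simp only: monomial_sum finite_lessThan poly_var_power)
qed

lemma poly_var_mem_poly_carrier: "i < n \<Longrightarrow> poly_var i \<in> poly_carrier n"
  by (simp add: poly_var_def poly_carrier_def)

lemma diff_mem_poly_carrier: "f \<in> poly_carrier n \<Longrightarrow> g \<in> poly_carrier n \<Longrightarrow> f - g \<in> poly_carrier n"
  using add_mem_poly_carrier[OF _ uminus_mem_poly_carrier, of f n g] by simp

lemma binomial_mem_toric_ideal:
  assumes "Poly_Mapping.keys \<alpha> \<subseteq> {..<n}" "Poly_Mapping.keys \<beta> \<subseteq> {..<n}"
  shows "(monomial \<alpha> - monomial \<beta> :: 'k::field mpoly) \<in> toric_ideal m n M \<longleftrightarrow> mat_exp m M \<alpha> = mat_exp m M \<beta>"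
  using assms by (simp add: toric_ideal_eq binomial_mem_toric_kernel diff_mem_poly_carrier monomial_mem_poly_carrier)

lemma scroll_poly_mem_poly_carrier:
  assumes "\<And>j. j \<le> Suc i \<Longrightarrow> x j \<in> poly_carrier n"
  shows "scroll_poly x i \<in> poly_carrier n"
  unfolding scroll_poly_def using assms
  by (intro sum_mem_poly_carrier mult_mem_poly_carrier power_mem_poly_carrier of_nat_mem_poly_carrier
      uminus_mem_poly_carrier one_mem_poly_carrier) auto

lemma last_poly_mem_poly_carrier:
  assumes "\<And>j. j \<le> d \<Longrightarrow> x j \<in> poly_carrier n" "w \<in> poly_carrier n" "d > 0"
  shows "last_poly x w d p q \<in> poly_carrier n"
proof -
  have "b mod d \<le> d" for b using assms(3) by (simp add: less_imp_le)
  then have "uv_monomial x d a b \<in> poly_carrier n" for a b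
    using assms(1) by (auto simp: uv_monomial_def intro!: mult_mem_poly_carrier power_mem_poly_carrier)
  then show ?thesis unfolding last_poly_def using assms(2)
    by (intro sum_mem_poly_carrier mult_mem_poly_carrier power_mem_poly_carrier of_nat_mem_poly_carrier
      uminus_mem_poly_carrier)
qed

locale toric_Mcd =
  fixes m d :: nat and c :: "nat \<Rightarrow> nat"
  assumes m: "m \<ge> 1" and d: "d > 1" and c1: "c 1 > 0" and c12: "c 1 \<ge> d * c 2"
begin

text \<open>Under \<open>x j = u * v ^ j\<close> the part of a monomial in \<open>x 0\<close>, ...,
  \<open>x d\<close> becomes \<open>u ^ xdeg \<alpha> * v ^ xweight \<alpha>\<close>.\<close>

definition xdeg :: "(nat \<Rightarrow>\<^sub>0 nat) \<Rightarrow> nat" where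
  "xdeg \<alpha> = (\<Sum>j\<le>d. Poly_Mapping.lookup \<alpha> j)"

definition xweight :: "(nat \<Rightarrow>\<^sub>0 nat) \<Rightarrow> nat" where
  "xweight \<alpha> = (\<Sum>j\<le>d. j * Poly_Mapping.lookup \<alpha> j)"

lemma xdeg_add: "xdeg (\<alpha> + \<beta>) = xdeg \<alpha> + xdeg \<beta>"
  and xweight_add: "xweight (\<alpha> + \<beta>) = xweight \<alpha> + xweight \<beta>"
  by (simp_all add: xdeg_def xweight_def lookup_add distrib_left sum.distrib)

lemma xdeg_single: "xdeg (Poly_Mapping.single i k) = (if i \<le> d then k else 0)"
  and xweight_single: "xweight (Poly_Mapping.single i k) = (if i \<le> d then i * k else 0)"
  by (simp_all add: xdeg_def xweight_def lookup_single when_def if_distrib cong: if_cong)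

definition yexp :: "(nat \<Rightarrow> nat) \<Rightarrow> nat \<Rightarrow>\<^sub>0 nat" where
  "yexp h = (\<Sum>k\<in>{1..<m}. Poly_Mapping.single (d + k) (h k))"

lemma lookup_yexp: "Poly_Mapping.lookup (yexp h) i = (if d < i \<and> i < m + d then h (i - d) else 0)"
proof -
  have "Poly_Mapping.lookup (yexp h) i = (\<Sum>k\<in>{1..<m}. if k = i - d \<and> d < i then h k else 0)"
    unfolding yexp_def lookup_sum by (intro sum.cong) (auto simp: lookup_single when_def)
  then show ?thesis by (cases "d < i") auto
qed

lemma xdeg_yexp: "xdeg (yexp h) = 0" and xweight_yexp: "xweight (yexp h) = 0"
  by (simp_all add: xdeg_def xweight_def lookup_yexp)

lemma split_variables: "{..<m + d} = {..d} \<union> (+) d ` {1..<m}"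
proof -
  have "(+) d ` {1..<m} = {d + 1..<m + d}" by (simp add: add.commute)
  then show ?thesis using m by auto
qed

text \<open>The columns \<open>0\<close> to \<open>d\<close> depend affinely on their index, so they
  contribute to each row only through \<open>xdeg\<close> and \<open>xweight\<close>.\<close>

lemma lookup_mat_exp_Mcd:
  assumes "Poly_Mapping.keys \<alpha> \<subseteq> {..<m + d}" "r < m"
  shows "Poly_Mapping.lookup (mat_exp m (Mcd m d c) \<alpha>) r =
    (if r = 0 then int (c 1) * int (xdeg \<alpha>) - int (c 2) * int (xweight \<alpha>)
     else int (c (r + 2)) * int (xweight \<alpha>) + int (c 1) * int (Poly_Mapping.lookup \<alpha> (d + r)))"
proof -
  let ?a = "\<lambda>i. int (Poly_Mapping.lookup \<alpha> i)"
  have "Poly_Mapping.lookup (mat_exp m (Mcd m d c) \<alpha>) r = (\<Sum>i<m + d. Mcd m d c r i * ?a i)"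
    using assms by (simp add: lookup_mat_exp[of "{..<m + d}"])
  also have "\<dots> = (\<Sum>j\<le>d. Mcd m d c r j * ?a j) + (\<Sum>k\<in>(+) d ` {1..<m}. Mcd m d c r k * ?a k)"
    unfolding split_variables by (rule sum.union_disjoint) auto
  also have "(\<Sum>k\<in>(+) d ` {1..<m}. Mcd m d c r k * ?a k) = (\<Sum>k\<in>{1..<m}. Mcd m d c r (d + k) * ?a (d + k))"
    by (subst sum.reindex) (auto simp: o_def)
  also have "\<dots> = (\<Sum>k\<in>{1..<m}. if k = r then int (c 1) * ?a (d + r) else 0)"
    using assms(2) by (intro sum.cong) (auto simp: Mcd_def)
  also have "\<dots> = (if r = 0 then 0 else int (c 1) * ?a (d + r))"
    using assms(2) by auto
  also have "(\<Sum>j\<le>d. Mcd m d c r j * ?a j) =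
      (if r = 0 then int (c 1) * int (xdeg \<alpha>) - int (c 2) * int (xweight \<alpha>)
       else int (c (r + 2)) * int (xweight \<alpha>))"
  proof (cases "r = 0")
    case True
    have "(\<Sum>j\<le>d. Mcd m d c r j * ?a j) = (\<Sum>j\<le>d. int (c 1) * ?a j - int (c 2) * (int j * ?a j))"
      using assms(2) by (intro sum.cong) (auto simp: True Mcd_def algebra_simps)
    then show ?thesis
      using True by (simp add: sum_subtractf xdeg_def xweight_def flip: sum_distrib_left)
  next
    case False
    have "(\<Sum>j\<le>d. Mcd m d c r j * ?a j) = (\<Sum>j\<le>d. int (c (r + 2)) * (int j * ?a j))"
      using assms(2) False by (intro sum.cong) (auto simp: Mcd_def algebra_simps)
    then show ?thesis
      using False by (simp add: xdeg_def xweight_def flip: sum_distrib_left)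
  qed
  finally show ?thesis by simp
qed

lemma mat_exp_Mcd_eq_iff:
  assumes "Poly_Mapping.keys \<alpha> \<subseteq> {..<m + d}" "Poly_Mapping.keys \<beta> \<subseteq> {..<m + d}"
  shows "mat_exp m (Mcd m d c) \<alpha> = mat_exp m (Mcd m d c) \<beta> \<longleftrightarrow>
    int (c 1) * int (xdeg \<alpha>) - int (c 2) * int (xweight \<alpha>) = int (c 1) * int (xdeg \<beta>) - int (c 2) * int (xweight \<beta>)
    \<and> (\<forall>r\<in>{1..<m}. int (c (r + 2)) * int (xweight \<alpha>) + int (c 1) * int (Poly_Mapping.lookup \<alpha> (d + r)) =
         int (c (r + 2)) * int (xweight \<beta>) + int (c 1) * int (Poly_Mapping.lookup \<beta> (d + r)))"
    (is "?L \<longleftrightarrow> ?Z \<and> ?R")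
proof -
  let ?e = "\<lambda>\<gamma>. Poly_Mapping.lookup (mat_exp m (Mcd m d c) \<gamma>)"
  have out: "?e \<gamma> r = 0" if "\<not> r < m" for \<gamma> r
    using that by (simp add: lookup_mat_exp[of "Poly_Mapping.keys \<gamma>"])
  have rows: "{..<m} = insert 0 {1..<m}" using m by auto
  have "?L \<longleftrightarrow> (\<forall>r\<in>{..<m}. ?e \<alpha> r = ?e \<beta> r)"
  proof
    assume R: "\<forall>r\<in>{..<m}. ?e \<alpha> r = ?e \<beta> r"
    show ?L
    proof (rule poly_mapping_eqI)
      fix r show "?e \<alpha> r = ?e \<beta> r" using R out[of r] by (cases "r < m") auto
    qed
  qed simp
  also have "\<dots> \<longleftrightarrow> ?e \<alpha> 0 = ?e \<beta> 0 \<and> (\<forall>r\<in>{1..<m}. ?e \<alpha> r = ?e \<beta> r)"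
    unfolding rows by simp
  also have "?e \<alpha> 0 = ?e \<beta> 0 \<longleftrightarrow> ?Z" using m by (simp add: lookup_mat_exp_Mcd assms)
  also have "(\<forall>r\<in>{1..<m}. ?e \<alpha> r = ?e \<beta> r) \<longleftrightarrow> ?R"
    by (intro ball_cong) (auto simp: lookup_mat_exp_Mcd assms)
  finally show ?thesis .
qed

section \<open>The entries divided by their greatest common divisor\<close>

definition g :: nat where "g = Gcd (c ` {1..m + 1})"
definition p :: nat where "p = c 1 div g"
definition q :: nat where "q = c 2 div g"
definition e :: "nat \<Rightarrow> nat" where "e k = c (k + 2) div g"

lemma g_dvd: "i \<in> {1..m + 1} \<Longrightarrow> g dvd c i"
  unfolding g_def by (intro Gcd_dvd) auto

lemma c_eq: "c 1 = g * p" "c 2 = g * q" "k \<in> {1..<m} \<Longrightarrow> c (k + 2) = g * e k"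
  using m g_dvd[of 1] g_dvd[of 2] g_dvd[of "k + 2"] by (auto simp: p_def q_def e_def)

lemma g_pos: "g > 0" and p_pos: "p > 0"
  using c1 c_eq(1) by (metis gr0I mult_zero_left, metis gr0I mult_zero_right)

lemma dq_le_p: "d * q \<le> p"
  using c12 g_pos unfolding c_eq(1,2) by (simp add: mult.left_commute)

text \<open>The two monomials exchange \<open>(u ^ q * v ^ p) ^ t\<close> for \<open>w ^ t\<close>;
  row \<open>0\<close> is unaffected because \<open>c 1 * q = c 2 * p\<close>.\<close>

lemma mat_exp_Mcd_eqI:
  assumes "Poly_Mapping.keys \<alpha> \<subseteq> {..<m + d}" "Poly_Mapping.keys \<beta> \<subseteq> {..<m + d}"
    and "xdeg \<alpha> = xdeg \<beta> + q * t" "xweight \<alpha> = xweight \<beta> + p * t"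
    and y: "\<And>k. k \<in> {1..<m} \<Longrightarrow> Poly_Mapping.lookup \<beta> (d + k) = Poly_Mapping.lookup \<alpha> (d + k) + e k * t"
  shows "mat_exp m (Mcd m d c) \<alpha> = mat_exp m (Mcd m d c) \<beta>"
  unfolding mat_exp_Mcd_eq_iff[OF assms(1,2)] assms(3,4) c_eq(1,2)
proof (intro conjI ballI)
  fix r assume r: "r \<in> {1..<m}"
  show "int (c (r + 2)) * int (xweight \<beta> + p * t) + int (g * p) * int (Poly_Mapping.lookup \<alpha> (d + r)) =
      int (c (r + 2)) * int (xweight \<beta>) + int (g * p) * int (Poly_Mapping.lookup \<beta> (d + r))"
    unfolding y[OF r] c_eq(3)[OF r] by (simp add: algebra_simps)
qed (simp add: algebra_simps)

text \<open>Since the reduced entries have gcd \<open>1\<close>, \<open>p\<close> divides the difference of the weights, and the two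
  monomials differ by the \<open>t\<close>-th power of the relation \<open>u\<^sup>q v\<^sup>p = w\<close>.\<close>
lemma mat_exp_Mcd_eqD:
  assumes "Poly_Mapping.keys \<alpha> \<subseteq> {..<m + d}" "Poly_Mapping.keys \<beta> \<subseteq> {..<m + d}"
    and eq: "mat_exp m (Mcd m d c) \<alpha> = mat_exp m (Mcd m d c) \<beta>" and le: "xweight \<beta> \<le> xweight \<alpha>"
  obtains t where "xdeg \<alpha> = xdeg \<beta> + q * t" "xweight \<alpha> = xweight \<beta> + p * t"
    "\<And>k. k \<in> {1..<m} \<Longrightarrow> Poly_Mapping.lookup \<beta> (d + k) = Poly_Mapping.lookup \<alpha> (d + k) + e k * t"
proof -
  define B where "B = xweight \<alpha> - xweight \<beta>"
  have wB: "xweight \<alpha> = xweight \<beta> + B" using le by (simp add: B_def)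
  have "int (c 1) * (int (xdeg \<alpha>) - int (xdeg \<beta>)) = int (c 2) * int B"
    using eq unfolding mat_exp_Mcd_eq_iff[OF assms(1,2)] wB by (simp add: algebra_simps)
  then have x: "int p * (int (xdeg \<alpha>) - int (xdeg \<beta>)) = int q * int B"
    using g_pos unfolding c_eq(1,2) by (simp add: mult.assoc)
  have y0: "int (c 1) * (int (Poly_Mapping.lookup \<beta> (d + k)) - int (Poly_Mapping.lookup \<alpha> (d + k)))
      = int (c (k + 2)) * int B" if k: "k \<in> {1..<m}" for k
  proof -
    have "int (c (k + 2)) * int (xweight \<beta> + B) + int (c 1) * int (Poly_Mapping.lookup \<alpha> (d + k)) =
         int (c (k + 2)) * int (xweight \<beta>) + int (c 1) * int (Poly_Mapping.lookup \<beta> (d + k))"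
      using eq k unfolding mat_exp_Mcd_eq_iff[OF assms(1,2)] wB by blast
    then show ?thesis by (simp add: algebra_simps)
  qed
  have y: "int p * (int (Poly_Mapping.lookup \<beta> (d + k)) - int (Poly_Mapping.lookup \<alpha> (d + k)))
      = int (e k) * int B" if "k \<in> {1..<m}" for k
    using y0[OF that] g_pos unfolding c_eq(1) c_eq(3)[OF that] by (simp add: mult.assoc)
  \<comment> \<open>It suffices that \<open>c 1 = g * p\<close> divides every
    \<open>B * c i\<close>: then it divides their gcd \<open>B * g\<close>, and \<open>g\<close>
    cancels.\<close>
  have "p dvd B"
  proof -
    have "c 1 dvd b" if b: "b \<in> (*) B ` c ` {1..m + 1}" for b
    proof -
      obtain i where i: "i \<in> {1..m + 1}" "b = B * c i" using b by auto
      have pd: "int p dvd int (c i div g) * int B"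
      proof -
        have "i = 1 \<or> i = 2 \<or> i - 2 \<in> {1..<m} \<and> i = i - 2 + 2" using i(1) by auto
        then consider "i = 1" | "i = 2" | k where "k \<in> {1..<m}" "i = k + 2" by blast
        then show ?thesis
        proof cases
          case 1
          then show ?thesis by (simp add: p_def)
        next
          case 2
          then have "int (c i div g) * int B = int p * (int (xdeg \<alpha>) - int (xdeg \<beta>))" using x by (simp add: q_def)
          then show ?thesis by simp
        next
          case 3
          then have "int (c i div g) = int (e k)" by (simp add: e_def)
          then show ?thesis using y[OF 3(1)] by (metis dvd_triv_left)
        qed
      qed
      obtain z where z: "c i = g * z" using g_dvd[OF i(1)] by blast
      then have "p dvd z * B" using pd g_pos by (simp flip: of_nat_mult)
      then have "g * p dvd g * (z * B)" by (rule mult_dvd_mono[OF dvd_refl])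
      then show ?thesis unfolding i(2) c_eq(1) z by (simp only: ac_simps)
    qed
    then have "c 1 dvd Gcd ((*) B ` c ` {1..m + 1})" by (rule Gcd_greatest)
    then have "c 1 dvd B * g" by (simp add: Gcd_mult g_def)
    then show ?thesis using g_pos unfolding c_eq(1) by (simp add: mult.commute)
  qed
  then obtain t where t: "B = p * t" by blast
  have "int p * (int (xdeg \<alpha>) - int (xdeg \<beta>)) = int p * (int q * int t)"
    using x unfolding t by (simp add: mult.left_commute)
  then have "int (xdeg \<alpha>) - int (xdeg \<beta>) = int q * int t" using p_pos by simp
  then have 1: "xdeg \<alpha> = xdeg \<beta> + q * t" by (simp add: algebra_simps flip: of_nat_mult of_nat_add)
  have 2: "Poly_Mapping.lookup \<beta> (d + k) = Poly_Mapping.lookup \<alpha> (d + k) + e k * t" if "k \<in> {1..<m}" for k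
  proof -
    have "int p * (int (Poly_Mapping.lookup \<beta> (d + k)) - int (Poly_Mapping.lookup \<alpha> (d + k)))
        = int p * (int (e k) * int t)"
      using y[OF that] unfolding t by (simp add: mult.left_commute)
    then have "int (Poly_Mapping.lookup \<beta> (d + k)) - int (Poly_Mapping.lookup \<alpha> (d + k)) = int (e k) * int t"
      using p_pos by simp
    then show ?thesis by (simp add: algebra_simps flip: of_nat_mult of_nat_add)
  qed
  show ?thesis by (rule that[OF 1 _ 2]) (simp_all add: wB t)
qed

section \<open>The equations cut out the toric ideal\<close>

definition w :: "'k::field mpoly" where
  "w = (\<Prod>k\<in>{1..<m}. poly_var (d + k) ^ e k)"

definition equations :: "'k::field mpoly list" where
  "equations = map (scroll_poly poly_var) [1..<d] @ [last_poly poly_var w d p q]"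

lemma length_equations: "length equations = d"
  using d by (simp add: equations_def)

lemma set_equations: "set equations = scroll_poly poly_var ` {1..<d} \<union> {last_poly poly_var w d p q}"
  by (auto simp: equations_def)

lemma monomial_split:
  assumes "Poly_Mapping.keys \<alpha> \<subseteq> {..<m + d}"
  shows "(monomial \<alpha> :: 'k::field mpoly) = (\<Prod>j\<le>d. poly_var j ^ Poly_Mapping.lookup \<alpha> j)
    * (\<Prod>k\<in>{1..<m}. poly_var (d + k) ^ Poly_Mapping.lookup \<alpha> (d + k))"
proof -
  have "(monomial \<alpha> :: 'k mpoly) = (\<Prod>j\<le>d. poly_var j ^ Poly_Mapping.lookup \<alpha> j)
    * (\<Prod>k\<in>(+) d ` {1..<m}. poly_var k ^ Poly_Mapping.lookup \<alpha> k)"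
    unfolding monomial_eq_prod[OF assms] split_variables by (rule prod.union_disjoint) auto
  then show ?thesis by (subst (asm) prod.reindex) (auto simp: o_def)
qed

text \<open>By symmetry \<open>\<alpha>\<close> may be taken to have the larger weight. Then
  \<open>monomial_relation\<close> trades the difference of the \<open>x\<close>-parts for
  \<open>w ^ t\<close>, which is exactly the excess of the \<open>y\<close>-part of
  \<open>\<beta>\<close> over that of \<open>\<alpha>\<close>.\<close>

lemma binomial_mem:
  assumes P: "prime_ideal_set P" and eqs: "set equations \<subseteq> (P :: 'k::field mpoly set)"
    and keys: "Poly_Mapping.keys \<alpha> \<subseteq> {..<m + d}" "Poly_Mapping.keys \<beta> \<subseteq> {..<m + d}"
    and eq: "mat_exp m (Mcd m d c) \<alpha> = mat_exp m (Mcd m d c) \<beta>"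
  shows "monomial \<alpha> - monomial \<beta> \<in> P"
proof -
  interpret prime_ideal_set P by (rule P)
  have "monomial \<alpha> \<approx> monomial \<beta>"
    if *: "xweight \<beta> \<le> xweight \<alpha>" "Poly_Mapping.keys \<alpha> \<subseteq> {..<m + d}" "Poly_Mapping.keys \<beta> \<subseteq> {..<m + d}"
      "mat_exp m (Mcd m d c) \<alpha> = mat_exp m (Mcd m d c) \<beta>" for \<alpha> \<beta>
  proof -
    let ?y = "\<lambda>\<gamma>. \<Prod>k\<in>{1..<m}. poly_var (d + k) ^ Poly_Mapping.lookup \<gamma> (d + k) :: 'k mpoly"
    let ?x = "\<lambda>\<gamma>. \<Prod>j\<le>d. poly_var j ^ Poly_Mapping.lookup \<gamma> j :: 'k mpoly"
    obtain t where t: "xdeg \<alpha> = xdeg \<beta> + q * t" "xweight \<alpha> = xweight \<beta> + p * t"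
      "\<And>k. k \<in> {1..<m} \<Longrightarrow> Poly_Mapping.lookup \<beta> (d + k) = Poly_Mapping.lookup \<alpha> (d + k) + e k * t"
      using mat_exp_Mcd_eqD[OF *(2,3,4,1)] by blast
    have "?x \<alpha> \<approx> ?x \<beta> * w ^ t"
    proof (rule monomial_relation[where p = p and q = q])
      show "scroll_poly poly_var i \<in> P" if "1 \<le> i" "i < d" for i
        using eqs that by (auto simp: set_equations)
      show "last_poly poly_var w d p q \<in> P" using eqs by (auto simp: set_equations)
    qed (use d dq_le_p p_pos t(1,2) in \<open>simp_all add: xdeg_def xweight_def\<close>)
    then have "?x \<alpha> * ?y \<alpha> \<approx> (?x \<beta> * w ^ t) * ?y \<alpha>" by (rule cong_mult) simp
    also have "w ^ t * ?y \<alpha> = ?y \<beta>"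
      unfolding w_def prod_power_distrib prod.distrib[symmetric]
      by (intro prod.cong) (simp_all add: t(3) power_add power_mult)
    then have "(?x \<beta> * w ^ t) * ?y \<alpha> = ?x \<beta> * ?y \<beta>" by (simp add: mult.assoc)
    finally show ?thesis by (simp only: monomial_split[OF *(2)] monomial_split[OF *(3)])
  qed
  from this[of \<beta> \<alpha>] this[of \<alpha> \<beta>] show ?thesis
    using cong_sym keys eq unfolding cong_def[symmetric] by (metis nle_le)
qed

lemma equations_mem_poly_carrier: "set equations \<subseteq> poly_carrier (m + d)"
proof -
  have "scroll_poly poly_var i \<in> poly_carrier (m + d)" if "i < d" for i
    using that m by (intro scroll_poly_mem_poly_carrier poly_var_mem_poly_carrier) simp
  moreover have "last_poly poly_var w d p q \<in> poly_carrier (m + d)"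
    using m d unfolding w_def
    by (intro last_poly_mem_poly_carrier poly_var_mem_poly_carrier prod_mem_poly_carrier power_mem_poly_carrier) auto
  ultimately show ?thesis by (auto simp: set_equations)
qed

text \<open>The toric kernel is a prime not containing \<open>x 0\<close>, so it contains the
  equations once it contains the relations \<open>x j = u * v ^ j\<close> and
  \<open>u ^ q * v ^ p = w\<close> with denominators cleared. These are binomials, with
  \<open>t = 0\<close> and \<open>t = 1\<close> in \<open>mat_exp_Mcd_eqI\<close>.\<close>

lemma equations_mem_toric_ideal: "set equations \<subseteq> (toric_ideal m (m + d) (Mcd m d c) :: 'k::field mpoly set)"
proof -
  define K :: "'k mpoly set" where "K = toric_kernel m (Mcd m d c)"
  interpret prime_ideal_set K unfolding K_def by (rule prime_toric_kernel)
  have md: "0 < m + d" "\<And>j. j \<le> d \<Longrightarrow> j < m + d" using m by auto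
  have x0: "poly_var 0 \<notin> K"
    by (simp add: K_def toric_kernel_def poly_var_def toric_map_single monomial_nonzero)
  have x: "poly_var 0 ^ j * poly_var j - poly_var 0 * poly_var 1 ^ j \<in> K" if j: "j \<le> d" for j
  proof -
    let ?\<alpha> = "Poly_Mapping.single 0 j + Poly_Mapping.single j 1 :: nat \<Rightarrow>\<^sub>0 nat"
    let ?\<beta> = "Poly_Mapping.single 0 1 + Poly_Mapping.single 1 j :: nat \<Rightarrow>\<^sub>0 nat"
    have "mat_exp m (Mcd m d c) ?\<alpha> = mat_exp m (Mcd m d c) ?\<beta>"
      using d j md(2)[OF j]
      by (intro mat_exp_Mcd_eqI[where t = 0])
        (auto simp: keys_add_nat xdeg_add xdeg_single xweight_add xweight_single lookup_add lookup_single)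
    then have "monomial ?\<alpha> - monomial ?\<beta> \<in> K" by (simp add: K_def binomial_mem_toric_kernel)
    then have "poly_var 0 ^ j * poly_var j ^ 1 - poly_var 0 ^ 1 * poly_var 1 ^ j \<in> K"
      by (simp only: poly_var_power mult_single mult_1)
    then show ?thesis by simp
  qed
  have yw: "poly_var 0 ^ q * poly_var 1 ^ p - poly_var 0 ^ p * w \<in> K"
  proof -
    let ?\<alpha> = "Poly_Mapping.single 0 q + Poly_Mapping.single 1 p :: nat \<Rightarrow>\<^sub>0 nat"
    let ?\<beta> = "Poly_Mapping.single 0 p + yexp e"
    have "mat_exp m (Mcd m d c) ?\<alpha> = mat_exp m (Mcd m d c) ?\<beta>"
    proof (rule mat_exp_Mcd_eqI[where t = 1])
      show "xdeg ?\<alpha> = xdeg ?\<beta> + q * 1" "xweight ?\<alpha> = xweight ?\<beta> + p * 1"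
        using d by (simp_all add: xdeg_add xweight_add xdeg_single xweight_single xdeg_yexp xweight_yexp)
    qed (use d in \<open>auto simp: keys_add_nat in_keys_iff lookup_add lookup_single lookup_yexp when_def split: if_splits\<close>)
    then have "monomial ?\<alpha> - monomial ?\<beta> \<in> K" by (simp add: K_def binomial_mem_toric_kernel)
    moreover have "(w :: 'k mpoly) = monomial (yexp e)" by (simp add: w_def yexp_def monomial_sum poly_var_power)
    ultimately show ?thesis by (simp add: poly_var_power mult_single)
  qed
  have "last_poly poly_var w d p q \<in> K"
    using d by (intro last_poly_mem x0 x[folded cong_def] yw[folded cong_def] dq_le_p) auto
  moreover have "scroll_poly poly_var i \<in> K" if "i \<in> {1..<d}" for i
    using that by (intro scroll_poly_mem x0 x[folded cong_def]) auto
  ultimately show ?thesis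
    using equations_mem_poly_carrier by (auto simp: set_equations toric_ideal_eq K_def)
qed

lemma toric_ideal_eq_radical:
  "(toric_ideal m (m + d) (Mcd m d c) :: 'k::field mpoly set) =
     radical_of (polyR (m + d)) (genideal (polyR (m + d)) (set equations))"
proof (rule radical_eqI[OF equations_mem_toric_ideal primeideal_toric_ideal])
  fix P :: "'k mpoly set" and f :: "'k mpoly"
  assume P: "prime_ideal_set P" "set equations \<subseteq> P" and f: "f \<in> toric_ideal m (m + d) (Mcd m d c)"
  show "f \<in> P"
  proof (rule toric_kernel_spanned_by_binomials[OF P(1)])
    show "f \<in> toric_kernel m (Mcd m d c)" using f by (simp add: toric_ideal_eq)
    show "monomial \<alpha> - monomial \<beta> \<in> P"
      if "\<alpha> \<in> Poly_Mapping.keys f" "\<beta> \<in> Poly_Mapping.keys f"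
        "mat_exp m (Mcd m d c) \<alpha> = mat_exp m (Mcd m d c) \<beta>" for \<alpha> \<beta>
      using f that by (intro binomial_mem[OF P]) (auto simp: toric_ideal_eq poly_carrier_def)
  qed
qed

text \<open>The columns of \<open>x 0\<close> and of the variables of index \<open>d + k\<close> are
  \<open>c 1\<close> times the standard basis vectors. Hence these \<open>m\<close> of the
  \<open>m + d\<close> variables are independent modulo the toric ideal, leaving \<open>d\<close>
  for the height.\<close>

lemma prime_height_upper:
  "prime_height (polyR (m + d) :: 'k::field mpoly ring) (toric_ideal m (m + d) (Mcd m d c)) \<le> enat d"
proof -
  let ?S = "insert 0 ((+) d ` {1..<m})"
  have S: "?S \<subseteq> {..<m + d}" using m by auto
  have "card ?S = Suc (card ((+) d ` {1..<m}))" using d by (intro card_insert_disjoint) auto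
  then have card: "card ?S = m" using m by (simp add: card_image)
  have "inj_on (mat_exp m (Mcd m d c)) {\<alpha>. Poly_Mapping.keys \<alpha> \<subseteq> ?S}"
  proof (rule inj_onI)
    fix \<alpha> \<beta> assume "\<alpha> \<in> {\<alpha>. Poly_Mapping.keys \<alpha> \<subseteq> ?S}" "\<beta> \<in> {\<alpha>. Poly_Mapping.keys \<alpha> \<subseteq> ?S}"
      and eq: "mat_exp m (Mcd m d c) \<alpha> = mat_exp m (Mcd m d c) \<beta>"
    then have keys: "Poly_Mapping.keys \<alpha> \<subseteq> ?S" "Poly_Mapping.keys \<beta> \<subseteq> ?S" by auto
    have out: "Poly_Mapping.lookup \<gamma> i = 0" if "Poly_Mapping.keys \<gamma> \<subseteq> ?S" "i \<notin> ?S" for \<gamma> :: "nat \<Rightarrow>\<^sub>0 nat" and i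
      using that by (auto simp: in_keys_iff)
    have x: "xdeg \<gamma> = Poly_Mapping.lookup \<gamma> 0" "xweight \<gamma> = 0" if "Poly_Mapping.keys \<gamma> \<subseteq> ?S" for \<gamma>
    proof -
      have z: "Poly_Mapping.lookup \<gamma> j = 0" if "j \<in> {..d}" "j \<noteq> 0" for j
        using out[OF \<open>Poly_Mapping.keys \<gamma> \<subseteq> ?S\<close>, of j] that by auto
      have "xdeg \<gamma> = (\<Sum>j\<le>d. if j = 0 then Poly_Mapping.lookup \<gamma> 0 else 0)"
        unfolding xdeg_def
      proof (rule sum.cong)
        fix j assume "j \<in> {..d}"
        then show "Poly_Mapping.lookup \<gamma> j = (if j = 0 then Poly_Mapping.lookup \<gamma> 0 else 0)"
          using z by (cases "j = 0") simp_all
      qed simp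
      then show "xdeg \<gamma> = Poly_Mapping.lookup \<gamma> 0" by simp
      show "xweight \<gamma> = 0" unfolding xweight_def
      proof (intro sum.neutral ballI)
        fix j assume "j \<in> {..d}"
        then show "j * Poly_Mapping.lookup \<gamma> j = 0" using z by (cases "j = 0") simp_all
      qed
    qed
    have "Poly_Mapping.keys \<alpha> \<subseteq> {..<m + d}" "Poly_Mapping.keys \<beta> \<subseteq> {..<m + d}" using keys S by auto
    note eq' = eq[unfolded mat_exp_Mcd_eq_iff[OF this] x[OF keys(1)] x[OF keys(2)]]
    show "\<alpha> = \<beta>"
    proof (rule poly_mapping_eqI)
      fix i
      consider "i = 0" | k where "k \<in> {1..<m}" "i = d + k" | "i \<notin> ?S" by blast
      then show "Poly_Mapping.lookup \<alpha> i = Poly_Mapping.lookup \<beta> i"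
      proof cases
        case 3
        then show ?thesis using out keys by metis
      qed (use eq' c1 in auto)
    qed
  qed
  from toric_has_growth[OF S this, where 'k = 'k]
  show ?thesis using prime_height_le[of "m + d" "toric_ideal m (m + d) (Mcd m d c) :: 'k mpoly set" m] card by simp
qed

text \<open>The parametrization in which \<open>x\<^sub>j\<close>, for \<open>i < j \<le> d\<close>, is multiplied by a fresh parameter \<open>s\<^sub>j\<close>.\<close>
definition chain_mat :: "nat \<Rightarrow> nat \<Rightarrow> nat \<Rightarrow> int" where
  "chain_mat i r j = (if r < m then Mcd m d c r j else if r = m + j \<and> i < j \<and> j \<le> d then 1 else 0)"

text \<open>Row \<open>m + j\<close> with \<open>i < j \<le> d\<close> records the exponent of
  \<open>x j\<close>; taking \<open>m + d + 1\<close> rows makes room for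
  \<open>j = d\<close>.\<close>

lemma mat_exp_chain_mat_eq_iff:
  "mat_exp (m + d + 1) (chain_mat i) \<alpha> = mat_exp (m + d + 1) (chain_mat i) \<beta> \<longleftrightarrow>
     mat_exp m (Mcd m d c) \<alpha> = mat_exp m (Mcd m d c) \<beta> \<and>
     (\<forall>j. i < j \<and> j \<le> d \<longrightarrow> Poly_Mapping.lookup \<alpha> j = Poly_Mapping.lookup \<beta> j)" (is "?L \<longleftrightarrow> ?R")
proof -
  let ?e = "\<lambda>\<gamma>. Poly_Mapping.lookup (mat_exp (m + d + 1) (chain_mat i) \<gamma>)"
  let ?f = "\<lambda>\<gamma>. Poly_Mapping.lookup (mat_exp m (Mcd m d c) \<gamma>)"
  have low: "?e \<gamma> r = ?f \<gamma> r" if "r < m" for \<gamma> r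
    using that by (simp add: lookup_mat_exp[of "Poly_Mapping.keys \<gamma>"] chain_mat_def)
  have high: "?e \<gamma> r = (if r \<le> m + d \<and> i < r - m then int (Poly_Mapping.lookup \<gamma> (r - m)) else 0)" "?f \<gamma> r = 0"
    if "\<not> r < m" for \<gamma> r
  proof -
    show "?f \<gamma> r = 0" using that by (simp add: lookup_mat_exp[of "Poly_Mapping.keys \<gamma>"])
    let ?S = "insert (r - m) (Poly_Mapping.keys \<gamma>)"
    have "(\<Sum>j\<in>?S. chain_mat i r j * int (Poly_Mapping.lookup \<gamma> j)) =
        (\<Sum>j\<in>?S. if j = r - m then (if i < j \<and> j \<le> d then int (Poly_Mapping.lookup \<gamma> j) else 0) else 0)"
      using that by (intro sum.cong) (auto simp: chain_mat_def)
    also have "\<dots> = (if i < r - m \<and> r - m \<le> d then int (Poly_Mapping.lookup \<gamma> (r - m)) else 0)"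
      by (subst sum.delta) auto
    moreover have "?e \<gamma> r = ((\<Sum>j\<in>?S. chain_mat i r j * int (Poly_Mapping.lookup \<gamma> j)) when r < m + d + 1)"
      by (rule lookup_mat_exp) auto
    ultimately show "?e \<gamma> r = (if r \<le> m + d \<and> i < r - m then int (Poly_Mapping.lookup \<gamma> (r - m)) else 0)"
      using that by auto
  qed
  show ?thesis
  proof
    assume L: ?L
    then have "?e \<alpha> r = ?e \<beta> r" for r by simp
    note e = this
    have "?f \<alpha> r = ?f \<beta> r" for r using e[of r] low[of r] high(2)[of r] by (cases "r < m") auto
    moreover have "Poly_Mapping.lookup \<alpha> j = Poly_Mapping.lookup \<beta> j" if "i < j" "j \<le> d" for j
      using e[of "m + j"] high(1)[of "m + j"] that by simp
    ultimately show ?R by (auto intro: poly_mapping_eqI)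
  next
    assume R: ?R
    show ?L
    proof (rule poly_mapping_eqI)
      fix r show "?e \<alpha> r = ?e \<beta> r"
        using R low[of r] high(1)[of r] by (cases "r < m") auto
    qed
  qed
qed

text \<open>The toric ideals of \<open>chain_mat i\<close> increase with \<open>i\<close>, as each
  step forgets one parameter, and the last one is the given ideal. An explicit binomial makes each
  step strict.\<close>

lemma prime_height_lower:
  "enat d \<le> prime_height (polyR (m + d) :: 'k::field mpoly ring) (toric_ideal m (m + d) (Mcd m d c))"
proof -
  let ?n = "m + d"
  define Q :: "nat \<Rightarrow> 'k mpoly set" where "Q i = toric_ideal (m + d + 1) ?n (chain_mat i)" for i
  have "\<forall>i\<le>d. primeideal (Q i) (polyR ?n)" by (simp add: Q_def primeideal_toric_ideal)
  moreover have "Q d = toric_ideal m ?n (Mcd m d c)"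
    unfolding Q_def by (intro equalityI toric_ideal_mono) (auto simp: mat_exp_chain_mat_eq_iff simp del: One_nat_def add_Suc_right)
  moreover have "Q i \<subset> Q (Suc i)" if i: "i < d" for i
  proof
    show "Q i \<subseteq> Q (Suc i)"
      unfolding Q_def by (intro toric_ideal_mono) (auto simp: mat_exp_chain_mat_eq_iff simp del: One_nat_def add_Suc_right)
    let ?j = "Suc i"
    \<comment> \<open>Both exponents have \<open>c 1\<close> times column \<open>?j\<close> as
      image. The binomial involves no \<open>x l\<close> with \<open>?j < l \<le> d\<close>, so it
      lies in \<open>Q ?j\<close>; its terms disagree in the exponent of \<open>x ?j\<close>, which
      \<open>Q i\<close> still records.\<close>
    let ?\<alpha> = "Poly_Mapping.single ?j (c 1) :: nat \<Rightarrow>\<^sub>0 nat"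
    let ?\<beta> = "Poly_Mapping.single 0 (c 1 - ?j * c 2) + yexp (\<lambda>k. ?j * c (k + 2))"
    have keys: "Poly_Mapping.keys ?\<alpha> \<subseteq> {..<?n}" "Poly_Mapping.keys ?\<beta> \<subseteq> {..<?n}"
      using i m by (auto simp: keys_add_nat in_keys_iff lookup_yexp split: if_splits)
    have "?j * c 2 \<le> d * c 2" using i by (intro mult_le_mono1) simp
    then have le: "?j * c 2 \<le> c 1" using c12 by linarith
    have "xdeg ?\<alpha> = c 1" "xweight ?\<alpha> = ?j * c 1" "xdeg ?\<beta> = c 1 - ?j * c 2" "xweight ?\<beta> = 0"
      using i by (simp_all add: xdeg_add xweight_add xdeg_single xweight_single xdeg_yexp xweight_yexp)
    moreover have "Poly_Mapping.lookup ?\<alpha> (d + r) = 0" "Poly_Mapping.lookup ?\<beta> (d + r) = ?j * c (r + 2)"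
      if "r \<in> {1..<m}" for r
      using that i d by (simp_all add: lookup_add lookup_single lookup_yexp)
    ultimately have eq: "mat_exp m (Mcd m d c) ?\<alpha> = mat_exp m (Mcd m d c) ?\<beta>"
      unfolding mat_exp_Mcd_eq_iff[OF keys] using le by (simp add: of_nat_diff algebra_simps)
    have lk\<beta>: "Poly_Mapping.lookup ?\<beta> j = 0" if "1 \<le> j" "j \<le> d" for j
      using that by (simp add: lookup_add lookup_single lookup_yexp)
    have "monomial ?\<alpha> - monomial ?\<beta> \<in> Q ?j"
      unfolding Q_def binomial_mem_toric_ideal[OF keys] mat_exp_chain_mat_eq_iff
      using eq lk\<beta> by (auto simp: lookup_single)
    moreover have "monomial ?\<alpha> - monomial ?\<beta> \<notin> Q i"
      unfolding Q_def binomial_mem_toric_ideal[OF keys] mat_exp_chain_mat_eq_iff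
      using lk\<beta>[of ?j] i c1 by (auto intro!: exI[of _ ?j])
    ultimately show "Q i \<noteq> Q ?j" by blast
  qed
  ultimately show ?thesis
    unfolding prime_height_def by (intro SUP_upper) blast
qed

lemma ideal_height_toric_ideal:
  "ideal_height (polyR (m + d) :: 'k::field mpoly ring) (toric_ideal m (m + d) (Mcd m d c)) = enat d"
  unfolding ideal_height_primeideal[OF primeideal_toric_ideal]
  using prime_height_upper prime_height_lower by (rule antisym)

lemma set_theoretic_ci_toric_ideal:
  "set_theoretic_ci (polyR (m + d) :: 'k::field mpoly ring) (toric_ideal m (m + d) (Mcd m d c))"
  unfolding set_theoretic_ci_def ideal_height_toric_ideal
  using equations_mem_poly_carrier length_equations toric_ideal_eq_radical
  by (intro exI[of _ equations]) simp

end

theorem theorem6p1: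
  fixes m d :: nat and c :: "nat \<Rightarrow> nat"
  assumes "m \<ge> 1" and "d > 1"
    and "c 1 > 0"
    and "c 1 \<ge> d * c 2"
    and "\<forall>j < m + d. \<exists>r < m. Mcd m d c r j \<noteq> 0"
  shows "ideal_height (polyR (m + d) :: 'k::field mpoly ring)
           (toric_ideal m (m + d) (Mcd m d c)) = enat d
    \<and> set_theoretic_ci (polyR (m + d) :: 'k::field mpoly ring)
           (toric_ideal m (m + d) (Mcd m d c))"
proof -
  interpret toric_Mcd m d c by unfold_locales (use assms in auto)
  show ?thesis using ideal_height_toric_ideal set_theoretic_ci_toric_ideal by blast
qed

end
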